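(* Let $a_h(\cdot,\cdot)$ be the spectral volume bilinear form and let $u_h(\cdot,t)\in V_h$, $t\in[0,T]$, be the solution of the semi-discrete spectral volume scheme $a_h(u_h,w_h^* )=(g,w_h^* )$ for all $w_h^*\in\mathcal V_h$. Set $\|u_h\|_E=\|u_h\|_0$ for the RSV method, and $\|u_h\|_E=|\|u_h|\|$ for the LSV method. Then for both the RSV and the LSV methods $$\frac12\frac{d}{dt}\|u_h\|_E^2\lesssim -\frac12(\alpha_x u_h,u_h)+a_h(u_h,u_h^* )+\|u_h\|_0^2 ,\qquad u_h^*=Tu_h .$$ Consequently, both the RSV and the LSV methods are stable in the sense that $$\|u_h(\cdot,t)\|_E\lesssim \|u_h(\cdot,0)\|_E,\qquad t\in(0,T].$$
   Context: Problem: fix an integer $k\ge1$ and $T>0$; $u_t+(\alpha u)_x=g(x,t)$ on $\Omega\times[0,T]$, $\Omega=[0,2\pi]$, $u(x,0)=u_0(x)$, periodic boundary conditions, with $u_0,\alpha=\alpha(x),g$ smooth; $\alpha$ may vanish and change sign and has finitely many turning points. Everything is understood $2\pi$-periodically in $x$. Mesh: $0=x_{1/2}<x_{3/2}<\dots<x_{N+1/2}=2\pi$, $\mathbf V_i=[x_{i-1/2},x_{i+1/2}]$, $h_i=|\mathbf V_i|$, $\bar h_i=h_i/2$, $h=\max_i h_i$, $x_{1/2}$ and $x_{N+1/2}$ identified. The mesh is shape-regular: $h\lesssim h_i$ for all $i$. On each element choose $-1=s_0<s_1<\dots<s_{k+1}=1$ and put $x_{i,j}=\bar h_i s_j+\frac12(x_{i-1/2}+x_{i+1/2})$,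 $\mathbf V_{i,j}=[x_{i,j},x_{i,j+1}]$, $0\le j\le k$. Let $L_n$ be the Legendre polynomial of degree $n$. LSV: $s_1,\dots,s_k$ are the zeros of $L_k$ on every element. RSV: if $\alpha(x_{i-1/2})>0$ and $\alpha(x_{i+1/2})>0$, then $s_1,\dots,s_{k+1}$ are the right Radau points (zeros of $L_{k+1}-L_k$); if both values are $<0$, then $s_0,\dots,s_k$ are the left Radau points (zeros of $L_{k+1}+L_k$); otherwise either of these two choices may be used on that element. Spaces: $V_h=\{v: v|_{\mathbf V_i}\in\mathcal P_k(\mathbf V_i)\ \forall i\}$; $\mathcal V_h$ is the space of functions constant on each $\mathbf V_{i,j}$, and $w^*_{i,j}$ denotes the value of $w^*\in\mathcal V_h$ on $\mathbf V_{i,j}$. Functions in the first argument of $a_h$ may depend (differentiably) on $t$. $(\cdot,\cdot)$ and $\|\cdot\|_0$ are the $L^2(\Omega)$ inner product and norm; $(\cdot,\cdot)_i$ is the $L^2(\mathbf V_i)$ inner product. Upwind flux: $\widehat v|_{i+1/2}=v^-(x_{i+1/2})$ if $\alpha(x_{i+1/2})>0$ and $v^+(x_{i+1/2})$ if $\alpha(x_{i+1/2})\le0$ ($v^\mp$ are left/right limits); $\widehat v=v$ at interior points $x_{i,j}$, $1\le j\le k$; the indices $(i,0)$ and $(i,k+1)$ refer to $x_{i-1/2}$ and $x_{i+1/2}$. Bilinear form: $a_h(v,w^* )=\sum_{i=1}^N a_{h,i}(v,w^* )$, $a_{h,i}(v,w^* )=\sum_{j=0}^k w^*_{i,j}\int_{x_{i,j}}^{x_{i,j+1}}v_t\,dx+\sum_{j=0}^k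 w^*_{i,j}\big(\alpha\widehat v|_{i,j+1}-\alpha\widehat v|_{i,j}\big)$. Transformation $T:V_h\to\mathcal V_h$, $w\mapsto w^*=Tw$: let $A_j$, $0\le j\le k+1$, be the weights on $[-1,1]$ of the quadrature at the $s_j$: for LSV the $k$-point Gauss–Legendre weights at $s_1,\dots,s_k$ with $A_0=A_{k+1}=0$; for right Radau points the $(k+1)$-point right Radau weights at $s_1,\dots,s_{k+1}$ with $A_0=0$; for left Radau points the left Radau weights at $s_0,\dots,s_k$ with $A_{k+1}=0$. Put $A_{i,j}=\bar h_iA_j$. Then $w^*_{i,0}=w^+(x_{i-1/2})+A_{i,0}w_x(x_{i,0})$, $w^*_{i,j}=w^*_{i,j-1}+A_{i,j}w_x(x_{i,j})$, $1\le j\le k$ (one-sided values from inside $\mathbf V_i$). Norm: for $v\in V_h$, $|\|v|\|^2=\sum_{i=1}^N(v,Tv)_i$, with $T$ built from the Gauss–Legendre points (LSV); this is a norm on $V_h$ equivalent to the $L^2$ norm. $X\lesssim Y$ means that $X$ can be bounded by $Y$ multiplied by a constant $C$ independent of the mesh size.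
   Formalization: In the energy inequality the constant multiplies only the term ||u_h||_0^2, not the whole right-hand side (false in that form), and the stability bound is stated only for g = 0 (for g ≠ 0 it fails, e.g. u_h(0) = 0, g = 1). *)

theory Defs
  imports "HOL-Analysis.Analysis" "HOL-Computational_Algebra.Polynomial"
begin

section \<open>Data of the continuous problem\<close>

definition smooth :: "(real \<Rightarrow> real) \<Rightarrow> bool" where
  "smooth f \<longleftrightarrow> (\<forall>n x. (deriv ^^ n) f field_differentiable (at x))"

text \<open>Smoothness of \<open>g(x,t)\<close> on \<open>\<real> \<times> [0,T]\<close>: \<open>D m n\<close> is the partial derivative of order \<open>m\<close> in
  \<open>x\<close> and \<open>n\<close> in \<open>t\<close> (one-sided at \<open>t = 0\<close> and \<open>t = T\<close>).\<close>

definition smooth_strip :: "real \<Rightarrow> (real \<Rightarrow> real \<Rightarrow> real) \<Rightarrow> bool" where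
  "smooth_strip T g \<longleftrightarrow> (\<exists>D :: nat \<Rightarrow> nat \<Rightarrow> real \<Rightarrow> real \<Rightarrow> real.
     (\<forall>x. \<forall>t\<in>{0..T}. D 0 0 x t = g x t) \<and>
     (\<forall>m n. continuous_on (UNIV \<times> {0..T}) (\<lambda>(x, t). D m n x t) \<and>
       (\<forall>x. \<forall>t\<in>{0..T}.
          ((\<lambda>y. D m n y t) has_real_derivative D (Suc m) n x t) (at x) \<and>
          ((\<lambda>s. D m n x s) has_real_derivative D m (Suc n) x t) (at t within {0..T}))))"

definition periodic :: "(real \<Rightarrow> real) \<Rightarrow> bool" where
  "periodic f \<longleftrightarrow> (\<forall>x. f (x + 2 * pi) = f x)"

text \<open>A turning point is a point at which the velocity changes sign.\<close>

definition turning_points :: "(real \<Rightarrow> real) \<Rightarrow> real set" where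
  "turning_points \<alpha> = {x \<in> {0..2 * pi}.
     \<forall>\<epsilon>>0. (\<exists>y. \<bar>y - x\<bar> < \<epsilon> \<and> \<alpha> y > 0) \<and> (\<exists>z. \<bar>z - x\<bar> < \<epsilon> \<and> \<alpha> z < 0)}"

section \<open>Reference points and quadrature weights\<close>

text \<open>Rodrigues' formula.\<close>

definition legendre :: "nat \<Rightarrow> real poly" where
  "legendre n = smult (1 / (2 ^ n * fact n)) ((pderiv ^^ n) ([:-1, 0, 1:] ^ n))"

datatype point_kind = Gauss | Right_Radau | Left_Radau

text \<open>Among the points \<open>s\<^sub>0 < \<dots> < s\<^bsub>k+1\<^esub>\<close> those with index in \<open>quad_idx\<close> carry the quadrature;
  they are exactly the zeros of \<open>quad_poly\<close>.\<close>

fun quad_idx :: "nat \<Rightarrow> point_kind \<Rightarrow> nat set" where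
  "quad_idx k Gauss = {1..k}"
| "quad_idx k Right_Radau = {1..k + 1}"
| "quad_idx k Left_Radau = {0..k}"

fun quad_poly :: "nat \<Rightarrow> point_kind \<Rightarrow> real poly" where
  "quad_poly k Gauss = legendre k"
| "quad_poly k Right_Radau = legendre (k + 1) - legendre k"
| "quad_poly k Left_Radau = legendre (k + 1) + legendre k"

definition ref_points :: "nat \<Rightarrow> point_kind \<Rightarrow> (nat \<Rightarrow> real) \<Rightarrow> bool" where
  "ref_points k K s \<longleftrightarrow> s 0 = -1 \<and> s (k + 1) = 1 \<and> (\<forall>j\<le>k. s j < s (j + 1)) \<and>
     s ` quad_idx k K = {x. poly (quad_poly k K) x = 0}"

text \<open>The Gauss and Radau rules are interpolatory, so each weight is the integral of the
  corresponding Lagrange basis polynomial.\<close>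

definition ref_weight :: "nat \<Rightarrow> point_kind \<Rightarrow> (nat \<Rightarrow> real) \<Rightarrow> nat \<Rightarrow> real" where
  "ref_weight k K s j =
     (if j \<in> quad_idx k K
      then integral {-1..1} (\<lambda>x. \<Prod>m\<in>quad_idx k K - {j}. (x - s m) / (s j - s m))
      else 0)"

section \<open>Meshes\<close>

text \<open>The cells are numbered \<open>1, \<dots>, cells M\<close>, and \<open>face M i\<close> is \<open>x\<^bsub>i+1/2\<^esub>\<close>, so that cell \<open>i\<close> is
  the interval from \<open>face M (i - 1)\<close> to \<open>face M i\<close>. On cell \<open>i\<close> the points \<open>s\<^sub>j\<close> are \<open>refpt M i j\<close>.\<close>

record sv_mesh =
  cells :: nat
  face :: "nat \<Rightarrow> real"
  kind :: "nat \<Rightarrow> point_kind"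
  refpt :: "nat \<Rightarrow> nat \<Rightarrow> real"

definition cell_len :: "sv_mesh \<Rightarrow> nat \<Rightarrow> real" where
  "cell_len M i = face M i - face M (i - 1)"

definition mesh_size :: "sv_mesh \<Rightarrow> real" where
  "mesh_size M = Max (cell_len M ` {1..cells M})"

definition pt :: "sv_mesh \<Rightarrow> nat \<Rightarrow> nat \<Rightarrow> real" where
  "pt M i j = cell_len M i / 2 * refpt M i j + (face M (i - 1) + face M i) / 2"

definition weight :: "nat \<Rightarrow> sv_mesh \<Rightarrow> nat \<Rightarrow> nat \<Rightarrow> real" where
  "weight k M i j = cell_len M i / 2 * ref_weight k (kind M i) (refpt M i) j"

datatype sv_method = LSV | RSV

fun point_choice :: "sv_method \<Rightarrow> (real \<Rightarrow> real) \<Rightarrow> sv_mesh \<Rightarrow> nat \<Rightarrow> bool" where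
  "point_choice LSV \<alpha> M i \<longleftrightarrow> kind M i = Gauss"
| "point_choice RSV \<alpha> M i \<longleftrightarrow>
     kind M i \<in> {Right_Radau, Left_Radau} \<and>
     (\<alpha> (face M (i - 1)) > 0 \<and> \<alpha> (face M i) > 0 \<longrightarrow> kind M i = Right_Radau) \<and>
     (\<alpha> (face M (i - 1)) < 0 \<and> \<alpha> (face M i) < 0 \<longrightarrow> kind M i = Left_Radau)"

text \<open>\<open>\<sigma>\<close> is the constant in the shape-regularity condition \<open>h \<lesssim> h\<^sub>i\<close>.\<close>

definition admissible_mesh ::
  "sv_method \<Rightarrow> nat \<Rightarrow> real \<Rightarrow> (real \<Rightarrow> real) \<Rightarrow> sv_mesh \<Rightarrow> bool" where
  "admissible_mesh meth k \<sigma> \<alpha> M \<longleftrightarrow>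
     face M 0 = 0 \<and> face M (cells M) = 2 * pi \<and>
     (\<forall>i<cells M. face M i < face M (i + 1)) \<and>
     (\<forall>i\<in>{1..cells M}. mesh_size M \<le> \<sigma> * cell_len M i \<and>
        point_choice meth \<alpha> M i \<and> ref_points k (kind M i) (refpt M i))"

section \<open>Discrete spaces\<close>

text \<open>An element of \<open>V\<^sub>h\<close> is discontinuous at the faces and two-valued there. It is represented by
  its polynomial pieces: \<open>v i\<close> is the polynomial on cell \<open>i\<close>, and one-sided limits at a face are
  values of the pieces on either side. A piecewise constant function on the control volumes
  \<open>[x\<^bsub>i,j\<^esub>, x\<^bsub>i,j+1\<^esub>]\<close> is represented by its values \<open>w i j\<close>. Values for other indices are irrelevant.\<close>

type_synonym broken_poly = "nat \<Rightarrow> real poly"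
type_synonym cv_fun = "nat \<Rightarrow> nat \<Rightarrow> real"

definition Vh :: "nat \<Rightarrow> sv_mesh \<Rightarrow> broken_poly set" where
  "Vh k M = {v. \<forall>i\<in>{1..cells M}. degree (v i) \<le> k}"

text \<open>The \<open>L\<^sup>2(\<Omega>)\<close> inner product with a piecewise constant function, where \<open>f i\<close> is the first
  argument on cell \<open>i\<close>.\<close>

definition cv_inner :: "nat \<Rightarrow> sv_mesh \<Rightarrow> (nat \<Rightarrow> real \<Rightarrow> real) \<Rightarrow> cv_fun \<Rightarrow> real" where
  "cv_inner k M f w =
     (\<Sum>i=1..cells M. \<Sum>j=0..k. w i j * integral {pt M i j..pt M i (j + 1)} (f i))"

definition L2_weighted :: "sv_mesh \<Rightarrow> (real \<Rightarrow> real) \<Rightarrow> broken_poly \<Rightarrow> broken_poly \<Rightarrow> real" where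
  "L2_weighted M b v w =
     (\<Sum>i=1..cells M. integral {face M (i - 1)..face M i}
        (\<lambda>x. b x * poly (v i) x * poly (w i) x))"

definition L2_norm :: "sv_mesh \<Rightarrow> broken_poly \<Rightarrow> real" where
  "L2_norm M v = sqrt (L2_weighted M (\<lambda>_. 1) v v)"

section \<open>Transformation, flux and bilinear form\<close>

primrec sv_trans :: "nat \<Rightarrow> sv_mesh \<Rightarrow> broken_poly \<Rightarrow> nat \<Rightarrow> nat \<Rightarrow> real" where
  "sv_trans k M w i 0 =
     poly (w i) (face M (i - 1)) + weight k M i 0 * poly (pderiv (w i)) (pt M i 0)"
| "sv_trans k M w i (Suc j) =
     sv_trans k M w i j + weight k M i (Suc j) * poly (pderiv (w i)) (pt M i (Suc j))"

text \<open>Limits at \<open>x\<^bsub>i+1/2\<^esub>\<close>, \<open>0 \<le> i \<le> cells M\<close>, with \<open>x\<^bsub>1/2\<^esub> = 0\<close> and \<open>x\<^bsub>N+1/2\<^esub> = 2\<pi>\<close> identified.\<close>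

definition left_lim :: "sv_mesh \<Rightarrow> broken_poly \<Rightarrow> nat \<Rightarrow> real" where
  "left_lim M v i =
     (let l = (if i = 0 then cells M else i) in poly (v l) (face M l))"

definition right_lim :: "sv_mesh \<Rightarrow> broken_poly \<Rightarrow> nat \<Rightarrow> real" where
  "right_lim M v i =
     (let l = (if i = cells M then 0 else i) in poly (v (l + 1)) (face M l))"

definition upwind :: "sv_mesh \<Rightarrow> (real \<Rightarrow> real) \<Rightarrow> broken_poly \<Rightarrow> nat \<Rightarrow> real" where
  "upwind M \<alpha> v i = (if \<alpha> (face M i) > 0 then left_lim M v i else right_lim M v i)"

definition flux :: "nat \<Rightarrow> sv_mesh \<Rightarrow> (real \<Rightarrow> real) \<Rightarrow> broken_poly \<Rightarrow> nat \<Rightarrow> nat \<Rightarrow> real" where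
  "flux k M \<alpha> v i j = \<alpha> (pt M i j) *
     (if j = 0 then upwind M \<alpha> v (i - 1)
      else if j = k + 1 then upwind M \<alpha> v i
      else poly (v i) (pt M i j))"

text \<open>\<open>v\<^sub>t\<close> on cell \<open>i\<close>, for \<open>v\<close> defined on \<open>[0,T]\<close>; one-sided at the endpoints.\<close>

definition time_deriv :: "real \<Rightarrow> (real \<Rightarrow> broken_poly) \<Rightarrow> real \<Rightarrow> nat \<Rightarrow> real \<Rightarrow> real" where
  "time_deriv T v t i x = vector_derivative (\<lambda>s. poly (v s i) x) (at t within {0..T})"

definition time_differentiable :: "real \<Rightarrow> sv_mesh \<Rightarrow> (real \<Rightarrow> broken_poly) \<Rightarrow> bool" where
  "time_differentiable T M v \<longleftrightarrow>
     (\<forall>t\<in>{0..T}. \<forall>i\<in>{1..cells M}. \<forall>x\<in>{face M (i - 1)..face M i}.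
        (\<lambda>s. poly (v s i) x) differentiable (at t within {0..T}))"

definition a_cell ::
  "real \<Rightarrow> nat \<Rightarrow> sv_mesh \<Rightarrow> (real \<Rightarrow> real) \<Rightarrow> (real \<Rightarrow> broken_poly) \<Rightarrow> real \<Rightarrow> cv_fun \<Rightarrow> nat \<Rightarrow> real"
  where
  "a_cell T k M \<alpha> v t w i =
     (\<Sum>j=0..k. w i j * integral {pt M i j..pt M i (j + 1)} (time_deriv T v t i)) +
     (\<Sum>j=0..k. w i j * (flux k M \<alpha> (v t) i (j + 1) - flux k M \<alpha> (v t) i j))"

text \<open>The form \<open>a\<^sub>h(v, w)\<close> at time \<open>t\<close>.\<close>

definition a_form ::
  "real \<Rightarrow> nat \<Rightarrow> sv_mesh \<Rightarrow> (real \<Rightarrow> real) \<Rightarrow> (real \<Rightarrow> broken_poly) \<Rightarrow> real \<Rightarrow> cv_fun \<Rightarrow> real"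
  where
  "a_form T k M \<alpha> v t w = (\<Sum>i=1..cells M. a_cell T k M \<alpha> v t w i)"

definition sv_solution ::
  "real \<Rightarrow> nat \<Rightarrow> sv_mesh \<Rightarrow> (real \<Rightarrow> real) \<Rightarrow> (real \<Rightarrow> real \<Rightarrow> real) \<Rightarrow> (real \<Rightarrow> broken_poly) \<Rightarrow> bool"
  where
  "sv_solution T k M \<alpha> g u \<longleftrightarrow>
     (\<forall>t\<in>{0..T}. u t \<in> Vh k M) \<and> time_differentiable T M u \<and>
     (\<forall>t\<in>{0..T}. \<forall>w :: cv_fun. a_form T k M \<alpha> u t w = cv_inner k M (\<lambda>i x. g x t) w)"

section \<open>Energy norm\<close>

text \<open>Used only with Gauss points on every cell; there \<open>(v, T w)\<close> is symmetric and positive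
  definite on \<open>V\<^sub>h\<close>.\<close>

definition triple_norm :: "nat \<Rightarrow> sv_mesh \<Rightarrow> broken_poly \<Rightarrow> real" where
  "triple_norm k M v = sqrt (cv_inner k M (\<lambda>i. poly (v i)) (sv_trans k M v))"

fun energy_norm :: "sv_method \<Rightarrow> nat \<Rightarrow> sv_mesh \<Rightarrow> broken_poly \<Rightarrow> real" where
  "energy_norm LSV k M v = triple_norm k M v"
| "energy_norm RSV k M v = L2_norm M v"

end

theory Submission
  imports Defs
begin

text \<open>Fix a cell with control points \<open>x\<^sub>0 < \<dots> < x\<^bsub>k+1\<^esub>\<close> and quadrature weights \<open>A\<^sub>j\<close>. The
  piecewise constant function \<open>T w\<close> jumps by \<open>A\<^sub>j w'(x\<^sub>j)\<close> at \<open>x\<^sub>j\<close>, so Abel summation turns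
  \<open>\<Sum>\<^sub>j (T w)\<^sub>j (F(x\<^bsub>j+1\<^esub>) - F(x\<^sub>j))\<close> into boundary terms minus the quadrature of \<open>w' F\<close>
  (\<open>sv_trans_summation_by_parts\<close>). This is integration by parts with a quadrature in place of the
  integral, and the theorem comes from using it for two choices of \<open>F\<close>.

  Time term: let \<open>F\<close> be a primitive of \<open>v\<close>. Then \<open>(v, T w)\<close> differs from \<open>(v, w)\<close> by the
  quadrature error of \<open>w' F\<close>, a polynomial of degree at most \<open>2k\<close>. All rules integrate degree
  \<open>2k - 1\<close> exactly, because their nodes are the zeros of a polynomial orthogonal to degrees below
  \<open>k\<close>; the error is therefore a multiple of the coefficient of \<open>x\<^bsup>2k\<^esup>\<close>, which is symmetric in the
  leading coefficients of \<open>v\<close> and \<open>w\<close>. The factor vanishes for Radau points, and for Gauss points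
  it is the integral of the square of the node polynomial (\<open>cell_pairing_eq\<close>,
  \<open>quad_defect_nonneg\<close>). So in both methods \<open>(v, T w)\<close> is a symmetric form, its diagonal is the
  squared energy norm, and this dominates the squared \<open>L\<^sup>2\<close> norm. Symmetry gives
  \<open>(u\<^sub>t, T u) = 1/2 d/dt (energy norm)\<^sup>2\<close> (\<open>energy_derivative\<close>).

  Flux term: let \<open>F\<close> be the numerical flux of \<open>\<alpha> u\<close>. Replacing the quadrature of \<open>\<alpha> u u'\<close> by its
  integral costs \<open>O((u, u))\<close>: with \<open>\<alpha>\<close> frozen on the cell the rule is exact, and the remaining
  factor \<open>h\<close> from \<open>\<alpha> - \<alpha>(x\<^sub>0)\<close> pays for the derivative through an inverse estimate. The integral
  is \<open>-1/2 (\<alpha>' u, u)\<close> plus face values, which combine with the upwind values to the nonnegative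
  jump terms \<open>1/2 |\<alpha>| [u]\<^sup>2\<close> (\<open>upwind_dissipation\<close>). Only at a Radau endpoint carrying quadrature
  weight may the flux value differ from the interior value used by the quadrature; the rule for
  choosing Radau points then forces \<open>\<alpha>\<close> to change sign in that cell, hence \<open>\<alpha> = O(h)\<close> there and
  the discrepancy is again \<open>O((u, u))\<close>, with the neighbouring cell entering through shape
  regularity (\<open>cell_flux_lower_bound\<close>). Altogether the flux term is at least
  \<open>1/2 (\<alpha>' u, u) - C (u, u)\<close> (\<open>flux_form_lower_bound\<close>), which is the first claim. For \<open>g = 0\<close> the
  bilinear form vanishes at the solution and Gronwall's inequality gives stability.\<close>

section \<open>Integrals of polynomials\<close>

definition primitive :: "real poly \<Rightarrow> real poly" where
  "primitive p = (\<Sum>n\<le>degree p. monom (coeff p n / real (Suc n)) (Suc n))"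

lemma coeff_primitive_Suc: "coeff (primitive p) (Suc n) = coeff p n / real (Suc n)"
proof -
  have "coeff (primitive p) (Suc n) = (\<Sum>m\<le>degree p. if m = n then coeff p m / real (Suc m) else 0)"
    unfolding primitive_def coeff_sum by (intro sum.cong) auto
  then show ?thesis
    by (auto simp: sum.delta not_le coeff_eq_0)
qed

lemma pderiv_primitive: "pderiv (primitive p) = p"
  by (rule poly_eqI) (simp add: coeff_pderiv coeff_primitive_Suc field_simps del: of_nat_Suc)

lemma degree_primitive: "degree (primitive p) \<le> Suc (degree p)"
  unfolding primitive_def by (intro degree_sum_le) (auto intro: order.trans[OF degree_monom_le])

lemma has_integral_pderiv:
  fixes P :: "real poly"
  assumes "a \<le> b"
  shows "(poly (pderiv P) has_integral (poly P b - poly P a)) {a..b}"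
  using assms
  by (intro fundamental_theorem_of_calculus)
     (auto simp flip: has_real_derivative_iff_has_vector_derivative intro!: DERIV_subset[OF poly_DERIV])

lemma integral_pderiv:
  fixes P :: "real poly"
  assumes "a \<le> b"
  shows "integral {a..b} (poly (pderiv P)) = poly P b - poly P a"
  using has_integral_pderiv[OF assms] by (rule integral_unique)

lemma poly_integrable [simp, intro]: "poly (p :: real poly) integrable_on {a..b}"
  by (intro integrable_continuous_interval continuous_on_poly continuous_on_id)

lemma integral_poly_add:
  "integral {a..b} (poly (p + q)) = integral {a..b} (poly p) + integral {a..b} (poly (q :: real poly))"
proof -
  have "poly (p + q) = (\<lambda>x. poly p x + poly q x)" by auto
  then show ?thesis by (simp add: integral_add)
qed

lemma integral_poly_smult:
  "integral {a..b} (poly (smult c p)) = c * integral {a..b} (poly (p :: real poly))"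
proof -
  have "poly (smult c p) = (\<lambda>x. c * poly p x)" by auto
  then show ?thesis by simp
qed

lemma integral_poly_sum:
  "finite I \<Longrightarrow> integral {a..b} (poly (\<Sum>j\<in>I. f j)) = (\<Sum>j\<in>I. integral {a..b} (poly (f j :: real poly)))"
  by (induction I rule: finite_induct) (simp_all add: integral_poly_add del: poly_add)

lemma integral_poly_square_nonneg: "0 \<le> integral {a..b} (poly (p * p :: real poly))"
  by (intro integral_nonneg) auto

lemma integral_poly_by_parts:
  fixes P Q :: "real poly"
  assumes "a \<le> b"
  shows "integral {a..b} (poly (pderiv P * Q)) =
    poly P b * poly Q b - poly P a * poly Q a - integral {a..b} (poly (P * pderiv Q))"
  using integral_pderiv[OF assms, of "P * Q"]
  by (simp add: pderiv_mult integral_poly_add mult.commute)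

section \<open>Legendre polynomials\<close>

text \<open>Taking \<open>l = x\<^sup>2 - 1\<close> treats both endpoints of \<open>[-1, 1]\<close> at once.\<close>

lemma pderiv_power_dvd:
  fixes l p :: "real poly"
  assumes "l ^ Suc r dvd p" shows "l ^ r dvd pderiv p"
proof -
  obtain q where "p = l ^ Suc r * q" using assms by (elim dvdE)
  then have "pderiv p = l ^ Suc r * pderiv q + q * (smult (real (Suc r)) (l ^ r) * pderiv l)"
    by (simp only: pderiv_mult pderiv_power_Suc of_nat_id)
  also have "\<dots> = l ^ r * (smult (real (Suc r)) (pderiv l * q) + l * pderiv q)"
    by (simp add: algebra_simps)
  finally have "pderiv p = \<dots>" .
  then show ?thesis by simp
qed

lemma higher_pderiv_power_dvd:
  fixes l p :: "real poly"
  assumes "l ^ (m + r) dvd p" shows "l ^ r dvd (pderiv ^^ m) p"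
  using assms
proof (induction m arbitrary: r)
  case (Suc m)
  then have "l ^ Suc r dvd (pderiv ^^ m) p" by (intro Suc.IH) (simp del: power_Suc)
  then show ?case by (simp add: pderiv_power_dvd del: power_Suc)
qed simp

lemma rodrigues_vanishes_at_ends:
  assumes "m < n" and x: "x = 1 \<or> x = (-1 :: real)"
  shows "poly ((pderiv ^^ m) ([:-1, 0, 1:] ^ n)) x = 0"
proof -
  obtain r where n: "n = m + Suc r" using assms less_imp_Suc_add by auto
  have "[:-1, 0, 1:] ^ Suc r dvd (pderiv ^^ m) ([:-1, 0, 1 :: real:] ^ n)"
    unfolding n by (rule higher_pderiv_power_dvd) simp
  then obtain q where "(pderiv ^^ m) ([:-1, 0, 1:] ^ n) = [:-1, 0, 1::real:] ^ Suc r * q"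
    by (elim dvdE)
  then have "poly ((pderiv ^^ m) ([:-1, 0, 1:] ^ n)) x = poly [:-1, 0, 1:] x ^ Suc r * poly q x"
    by (simp only: poly_mult poly_power)
  also have "poly [:-1, 0, 1:] x = 0" using x by auto
  finally show ?thesis by simp
qed

text \<open>Each of the \<open>m\<close> derivatives is moved onto \<open>q\<close>; the boundary terms vanish because \<open>\<plusminus>1\<close> are
  zeros of order \<open>n\<close> of \<open>(x\<^sup>2 - 1)\<^sup>n\<close>. The hypothesis on \<open>q\<close> says \<open>degree q < m\<close>, in a form that
  includes \<open>q = 0\<close> and that differentiation visibly preserves.\<close>

lemma rodrigues_orthogonal:
  fixes q :: "real poly"
  assumes "m \<le> n" "\<And>j. m \<le> j \<Longrightarrow> coeff q j = 0"
  shows "integral {-1..1} (poly ((pderiv ^^ m) ([:-1, 0, 1:] ^ n) * q)) = 0"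
  using assms
proof (induction m arbitrary: q)
  case 0
  then have "q = 0" by (intro poly_eqI) auto
  then show ?case by simp
next
  case (Suc m)
  have "integral {-1..1} (poly ((pderiv ^^ m) ([:-1, 0, 1:] ^ n) * pderiv q)) = 0"
    using Suc.prems by (intro Suc.IH) (auto simp: coeff_pderiv)
  then show ?case
    using Suc.prems unfolding funpow.simps o_apply
    by (subst integral_poly_by_parts) (auto simp: rodrigues_vanishes_at_ends)
qed

lemma legendre_orthogonal:
  assumes "\<And>j. n \<le> j \<Longrightarrow> coeff q j = 0"
  shows "integral {-1..1} (poly (legendre n * q)) = 0"
  unfolding legendre_def
  by (simp only: mult_smult_left integral_poly_smult rodrigues_orthogonal[OF order.refl assms] mult_zero_right)

lemma degree_higher_pderiv: "degree ((pderiv ^^ m) p) = degree (p :: real poly) - m"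
  by (induction m) (auto simp: degree_pderiv)

lemma degree_legendre: "degree (legendre n) = n"
proof -
  have "degree ([:-1, 0, 1::real:] ^ n) = 2 * n" by (subst degree_power_eq) auto
  then show ?thesis by (simp add: legendre_def degree_higher_pderiv)
qed

section \<open>Interpolatory quadrature\<close>

definition lagrange_basis :: "'i set \<Rightarrow> ('i \<Rightarrow> real) \<Rightarrow> 'i \<Rightarrow> real poly" where
  "lagrange_basis I s j = (\<Prod>m\<in>I - {j}. smult (1 / (s j - s m)) [:- s m, 1:])"

lemma poly_lagrange_basis:
  "poly (lagrange_basis I s j) x = (\<Prod>m\<in>I - {j}. (x - s m) / (s j - s m))"
  unfolding lagrange_basis_def poly_prod by (intro prod.cong) (auto simp: field_simps diff_divide_distrib)

lemma lagrange_basis_nodes: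
  assumes "finite I" "inj_on s I" "i \<in> I" "j \<in> I"
  shows "poly (lagrange_basis I s j) (s i) = (if i = j then 1 else 0)"
proof (cases "i = j")
  case True
  have "(s j - s m) / (s j - s m) = 1" if "m \<in> I - {j}" for m
    using that assms by (auto dest: inj_onD)
  with True show ?thesis by (simp add: poly_lagrange_basis)
next
  case False
  then show ?thesis using assms unfolding poly_lagrange_basis
    by (simp, intro bexI[of _ i]) auto
qed

lemma degree_lagrange_basis:
  assumes "finite I" "j \<in> I"
  shows "degree (lagrange_basis I s j) \<le> card I - 1"
proof -
  have "degree (lagrange_basis I s j) \<le> (\<Sum>m\<in>I - {j}. degree (smult (1 / (s j - s m)) [:- s m, 1:]))"
    unfolding lagrange_basis_def
    by (rule degree_prod_sum_le[unfolded o_def]) (use assms in auto)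
  also have "\<dots> \<le> (\<Sum>m\<in>I - {j}. 1)" by (intro sum_mono) (auto intro: order.trans[OF degree_smult_le])
  finally show ?thesis using assms by simp
qed

lemma lagrange_interpolation:
  assumes "finite I" "inj_on s I" "degree p < card I"
  shows "p = (\<Sum>j\<in>I. smult (poly p (s j)) (lagrange_basis I s j))"
proof (rule poly_eqI_degree[of "s ` I"])
  fix x assume "x \<in> s ` I"
  then obtain i where i: "i \<in> I" "x = s i" by auto
  have "(\<Sum>j\<in>I. poly p (s j) * poly (lagrange_basis I s j) (s i)) = (\<Sum>j\<in>I. if j = i then poly p (s j) else 0)"
    using assms i by (intro sum.cong) (auto simp: lagrange_basis_nodes)
  then show "poly p x = poly (\<Sum>j\<in>I. smult (poly p (s j)) (lagrange_basis I s j)) x"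
    using i assms by (simp add: poly_sum)
next
  show "card (s ` I) > degree p" using assms by (simp add: card_image)
  have "degree (\<Sum>j\<in>I. smult (poly p (s j)) (lagrange_basis I s j)) \<le> card I - 1"
    using assms degree_lagrange_basis[of I _ s] by (intro degree_sum_le) auto
  then show "card (s ` I) > degree (\<Sum>j\<in>I. smult (poly p (s j)) (lagrange_basis I s j))"
    using assms by (simp add: card_image)
qed

text \<open>Gauss's argument: divide \<open>p\<close> by the node polynomial \<open>W\<close>. The quotient has degree below \<open>m\<close>
  and contributes nothing to the integral, the remainder agrees with \<open>p\<close> at the nodes and is
  reproduced by interpolation.\<close>

lemma interpolatory_quadrature_exact:
  fixes p W :: "real poly"
  assumes I: "finite I" "inj_on s I" "I \<noteq> {}"
    and W: "degree W = card I" "\<And>j. j \<in> I \<Longrightarrow> poly W (s j) = 0"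
    and orth: "\<And>q. (\<And>n. m \<le> n \<Longrightarrow> coeff q n = 0) \<Longrightarrow> integral {a..b} (poly (W * q)) = 0"
    and p: "degree p < card I + m"
  shows "integral {a..b} (poly p) = (\<Sum>j\<in>I. integral {a..b} (poly (lagrange_basis I s j)) * poly p (s j))"
proof -
  define d r where "d = p div W" and "r = p mod W"
  have pdr: "p = W * d + r" by (simp add: d_def r_def)
  have card: "card I > 0" using I by (simp add: card_gt_0_iff)
  then have W0: "W \<noteq> 0" using W by auto
  have r: "degree r < card I" using degree_mod_less[OF W0, of p] W card unfolding r_def by auto
  have "coeff d n = 0" if "m \<le> n" for n
  proof (cases "d = 0")
    case False
    have deg: "degree (W * d) = card I + degree d" using W0 False W by (simp add: degree_mult_eq)
    then have "degree p = card I + degree d" using r unfolding pdr by (subst degree_add_eq_left) auto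
    then show ?thesis using p that by (intro coeff_eq_0) simp
  qed simp
  then have "integral {a..b} (poly (W * d)) = 0" by (rule orth)
  then have "integral {a..b} (poly p) = integral {a..b} (poly r)"
    by (subst pdr) (simp add: integral_poly_add)
  also have "\<dots> = (\<Sum>j\<in>I. poly r (s j) * integral {a..b} (poly (lagrange_basis I s j)))"
    by (subst lagrange_interpolation[OF I(1,2) r]) (simp add: integral_poly_sum integral_poly_smult I)
  also have "\<dots> = (\<Sum>j\<in>I. integral {a..b} (poly (lagrange_basis I s j)) * poly p (s j))"
    by (intro sum.cong) (auto simp: pdr W)
  finally show ?thesis .
qed

text \<open>The rule is exact for the square of a Lagrange basis polynomial, and applied to it returns the
  weight. As the weights add up to the length of the interval, their signs make quadrature bounds
  uniform in the mesh.\<close>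

lemma interpolatory_weight_nonneg:
  fixes W :: "real poly"
  assumes I: "finite I" "inj_on s I" "j \<in> I"
    and W: "degree W = card I" "\<And>j. j \<in> I \<Longrightarrow> poly W (s j) = 0"
    and orth: "\<And>q. (\<And>n. m \<le> n \<Longrightarrow> coeff q n = 0) \<Longrightarrow> integral {a..b} (poly (W * q)) = 0"
    and m: "card I \<le> m + 1"
  shows "0 \<le> integral {a..b} (poly (lagrange_basis I s j))"
proof -
  let ?l = "lagrange_basis I s"
  have pos: "card I > 0" using I by (auto simp: card_gt_0_iff)
  have "degree (?l j * ?l j) \<le> (card I - 1) + (card I - 1)"
    using degree_lagrange_basis[OF I(1,3), of s] by (intro order.trans[OF degree_mult_le] add_mono)
  then have "degree (?l j * ?l j) < card I + m" using m pos by linarith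
  moreover have "I \<noteq> {}" using I by auto
  ultimately have "integral {a..b} (poly (?l j * ?l j)) = (\<Sum>i\<in>I. integral {a..b} (poly (?l i)) * poly (?l j * ?l j) (s i))"
    using I W orth by (intro interpolatory_quadrature_exact) auto
  also have "\<dots> = (\<Sum>i\<in>I. if i = j then integral {a..b} (poly (?l i)) else 0)"
    by (intro sum.cong) (auto simp: lagrange_basis_nodes I)
  also have "\<dots> = integral {a..b} (poly (?l j))" using I by simp
  finally show ?thesis using integral_poly_square_nonneg[of a b "?l j"] by simp
qed

section \<open>Gauss and Radau rules on the reference interval\<close>

lemma ref_points_strict_mono:
  assumes "ref_points k K s" "i < j" "j \<le> k + 1"
  shows "s i < s j"
  using assms(2,3)
proof (induction j)
  case (Suc j)
  have "s j < s (Suc j)" using assms(1) Suc.prems by (auto simp: ref_points_def)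
  then show ?case using Suc by (cases "i = j") auto
qed simp

lemma quad_idx_subset: "quad_idx k K \<subseteq> {..k + 1}" by (cases K) auto

lemma finite_quad_idx [simp]: "finite (quad_idx k K)" by (cases K) auto

lemma inj_on_ref_points:
  assumes "ref_points k K s" shows "inj_on s {..k + 1}"
  by (rule linorder_inj_onI) (use ref_points_strict_mono[OF assms] in \<open>force+\<close>)

text \<open>The zeros of \<open>quad_poly\<close> are as many as its degree, so they are simple and it is the node
  polynomial up to a factor. Together with the orthogonality that follows, this puts the three rules
  on the same footing: each integrates degrees below \<open>card (quad_idx k K) + k\<close> exactly, that is
  up to \<open>2k - 1\<close> for Gauss and up to \<open>2k\<close> for Radau points.\<close>

lemma degree_quad_poly: "degree (quad_poly k K) = card (quad_idx k K)"
proof -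
  have "degree (legendre (Suc k) + c) = Suc k" if "degree c = k" for c
    using that by (subst degree_add_eq_left) (auto simp: degree_legendre)
  from this[of "legendre k"] this[of "- legendre k"] show ?thesis
    by (cases K) (auto simp: degree_legendre)
qed

lemma quad_poly_orthogonal:
  assumes "\<And>n. k \<le> n \<Longrightarrow> coeff q n = 0"
  shows "integral {-1..1} (poly (quad_poly k K * q)) = 0"
proof -
  have 1: "integral {-1..1} (poly (legendre k * q)) = 0" using assms by (rule legendre_orthogonal)
  have 2: "integral {-1..1} (poly (legendre (k + 1) * q)) = 0" using assms by (intro legendre_orthogonal) auto
  have "legendre (k + 1) * q - legendre k * q = legendre (k + 1) * q + smult (-1) (legendre k * q)" by simp
  then show ?thesis using 1 2
    by (cases K) (simp_all only: quad_poly.simps ring_distribs left_diff_distrib integral_poly_add integral_poly_smult)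
qed

lemma ref_weight_eq:
  "ref_weight k K s j =
     (if j \<in> quad_idx k K then integral {-1..1} (poly (lagrange_basis (quad_idx k K) s j)) else 0)"
proof -
  have "poly (lagrange_basis (quad_idx k K) s j) = (\<lambda>x. \<Prod>m\<in>quad_idx k K - {j}. (x - s m) / (s j - s m))"
    by (rule ext) (rule poly_lagrange_basis)
  then show ?thesis by (simp add: ref_weight_def)
qed

lemma quad_poly_zero:
  assumes "ref_points k K s" "j \<in> quad_idx k K" shows "poly (quad_poly k K) (s j) = 0"
  using assms unfolding ref_points_def by blast

lemma ref_quadrature_exact:
  assumes "ref_points k K s" "k \<ge> 1" "degree p < card (quad_idx k K) + k"
  shows "integral {-1..1} (poly p) = (\<Sum>j\<le>k + 1. ref_weight k K s j * poly p (s j))"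
proof -
  let ?I = "quad_idx k K"
  have "integral {-1..1} (poly p) = (\<Sum>j\<in>?I. integral {-1..1} (poly (lagrange_basis ?I s j)) * poly p (s j))"
    using assms inj_on_subset[OF inj_on_ref_points[OF assms(1)] quad_idx_subset]
    by (intro interpolatory_quadrature_exact[of _ _ "quad_poly k K"])
       (auto simp: degree_quad_poly quad_poly_zero quad_poly_orthogonal, cases K, auto)
  also have "\<dots> = (\<Sum>j\<in>?I. ref_weight k K s j * poly p (s j))"
    by (intro sum.cong) (auto simp: ref_weight_eq)
  also have "\<dots> = (\<Sum>j\<le>k + 1. ref_weight k K s j * poly p (s j))"
    using quad_idx_subset[of k K] by (intro sum.mono_neutral_left) (auto simp: ref_weight_def)
  finally show ?thesis .
qed

lemma ref_weight_nonneg: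
  assumes "ref_points k K s"
  shows "0 \<le> ref_weight k K s j"
proof (cases "j \<in> quad_idx k K")
  case True
  have "card (quad_idx k K) \<le> k + 1" by (cases K) auto
  with True show ?thesis
    using assms inj_on_subset[OF inj_on_ref_points[OF assms(1)] quad_idx_subset]
    unfolding ref_weight_eq
    by (auto intro!: interpolatory_weight_nonneg[of _ _ _ "quad_poly k K" k]
             simp: degree_quad_poly quad_poly_zero quad_poly_orthogonal)
qed (simp add: ref_weight_def)

section \<open>Inverse estimates\<close>

lemma integral_affine:
  fixes p :: "real poly"
  assumes "a \<le> b"
  shows "integral {a..b} (poly p) =
    (b - a) / 2 * integral {-1..1} (poly (pcompose p [:(a + b) / 2, (b - a) / 2:]))"
proof -
  define P \<Phi> where "P = primitive p" and "\<Phi> = [:(a + b) / 2, (b - a) / 2:]"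
  have P: "pderiv P = p" by (simp add: P_def pderiv_primitive)
  have "smult ((b - a) / 2) (pcompose p \<Phi>) = pderiv (pcompose P \<Phi>)"
    unfolding pderiv_pcompose P by (simp add: \<Phi>_def pderiv_pCons)
  then have "(b - a) / 2 * integral {-1..1} (poly (pcompose p \<Phi>)) =
      poly (pcompose P \<Phi>) 1 - poly (pcompose P \<Phi>) (-1)"
    by (simp only: integral_poly_smult[symmetric], subst integral_pderiv) auto
  also have "\<dots> = poly P b - poly P a"
    by (simp add: poly_pcompose \<Phi>_def field_simps)
  also have "\<dots> = integral {a..b} (poly p)"
    using integral_pderiv[OF assms, of P] by (simp add: P)
  finally show ?thesis by (simp add: \<Phi>_def)
qed

lemma integral_poly_square_pos:
  fixes p :: "real poly"
  assumes "a < b" "p \<noteq> 0"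
  shows "0 < integral {a..b} (poly (p * p))"
proof -
  have "integral {a..b} (poly (p * p)) \<noteq> 0"
  proof
    assume "integral {a..b} (poly (p * p)) = 0"
    then have "\<forall>x\<in>{a..b}. poly (p * p) x = 0"
      using assms
      by (subst (asm) integral_eq_0_iff) (auto intro!: continuous_intros)
    then have "{a..b} \<subseteq> {x. poly p x = 0}" by auto
    then have "finite {a..b}" using poly_roots_finite[OF assms(2)] finite_subset by blast
    then show False using assms by (simp add: infinite_Icc)
  qed
  then show ?thesis using integral_poly_square_nonneg[of a b p] by linarith
qed

text \<open>Induction on the degree bound. Subtracting a multiple of the Legendre polynomial of degree \<open>m\<close>
  lowers the degree, and by orthogonality the two parts do not exceed \<open>p\<close> in the \<open>L\<^sup>2\<close> norm.\<close>

lemma inverse_estimate_ref: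
  "\<exists>K\<ge>0. \<forall>p :: real poly. (\<forall>n\<ge>m. coeff p n = 0) \<longrightarrow> (\<forall>x\<in>{-1..1}.
     (poly p x)\<^sup>2 \<le> K * integral {-1..1} (poly (p * p)) \<and>
     (poly (pderiv p) x)\<^sup>2 \<le> K * integral {-1..1} (poly (p * p)))"
proof (induction m)
  case 0
  have "(\<forall>n\<ge>0. coeff p n = 0) \<longleftrightarrow> p = 0" for p :: "real poly"
    by (simp add: poly_eq_iff)
  then show ?case by (simp only:) (intro exI[of _ 0], simp)
next
  case (Suc m)
  then obtain K where K: "K \<ge> 0"
    and IH: "\<And>(p :: real poly) x. \<forall>n\<ge>m. coeff p n = 0 \<Longrightarrow> x \<in> {-1..1} \<Longrightarrow>
       (poly p x)\<^sup>2 \<le> K * integral {-1..1} (poly (p * p)) \<and>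
       (poly (pderiv p) x)\<^sup>2 \<le> K * integral {-1..1} (poly (p * p))"
    by meson
  define L where "L = legendre m"
  define S where "S = integral {-1..1} (poly (L * L))"
  have lead: "coeff L m \<noteq> 0"
  proof (cases "m = 0")
    case True
    then show ?thesis by (simp add: L_def legendre_def)
  next
    case False
    then show ?thesis using degree_legendre[of m] unfolding L_def by (metis degree_0 leading_coeff_0_iff)
  qed
  then have S: "S > 0" unfolding S_def by (intro integral_poly_square_pos) auto
  have "bounded ((\<lambda>x. (poly L x)\<^sup>2 + (poly (pderiv L) x)\<^sup>2) ` {-1..1})"
    by (intro compact_imp_bounded compact_continuous_image continuous_intros) auto
  then obtain B where "\<forall>y\<in>(\<lambda>x. (poly L x)\<^sup>2 + (poly (pderiv L) x)\<^sup>2) ` {-1..1}. norm y \<le> B"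
    by (auto simp: bounded_iff)
  then have B: "(poly L x)\<^sup>2 + (poly (pderiv L) x)\<^sup>2 \<le> B" if "x \<in> {-1..1}" for x
    using that by force
  have B0: "B \<ge> 0" using B[of 0] by (auto intro: order.trans[rotated])
  have main: "(poly p x)\<^sup>2 \<le> (2 * B / S + 2 * K) * integral {-1..1} (poly (p * p)) \<and>
      (poly (pderiv p) x)\<^sup>2 \<le> (2 * B / S + 2 * K) * integral {-1..1} (poly (p * p))"
    if p: "\<forall>n\<ge>Suc m. coeff p n = 0" and x: "x \<in> {-1..1}" for p x
  proof -
    define c where "c = coeff p m / coeff L m"
    define r where "r = p - smult c L"
    have "coeff r n = 0" if "n \<ge> m" for n
      using that p lead degree_legendre[of m]
      by (cases "n = m") (auto simp: r_def c_def L_def coeff_eq_0)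
    then have r: "\<forall>n\<ge>m. coeff r n = 0" by blast
    define I R where "I = integral {-1..1} (poly (p * p))" and "R = integral {-1..1} (poly (r * r))"
    have pr: "p = smult c L + r" by (simp add: r_def)
    \<comment> \<open>The mixed term integrates to zero.\<close>
    have "p * p = smult (c\<^sup>2) (L * L) + smult (2 * c) (L * r) + r * r"
      unfolding pr
      by (rule poly_eq_poly_eq_iff[THEN iffD1], rule ext, simp add: algebra_simps power2_eq_square)
    then have I: "I = c\<^sup>2 * S + R"
      using legendre_orthogonal[of m r] r
      by (simp only: I_def R_def S_def integral_poly_add integral_poly_smult L_def mult_zero_right add_0_right)
    have R0: "R \<ge> 0" unfolding R_def by (rule integral_poly_square_nonneg)
    have cS: "c\<^sup>2 * S \<le> I" using I R0 by simp
    have RI: "R \<le> I" using I S by simp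
    have I0: "I \<ge> 0" using R0 RI by simp
    have step: "(c * l + y)\<^sup>2 \<le> (2 * B / S + 2 * K) * I" if "l\<^sup>2 \<le> B" "y\<^sup>2 \<le> K * R" for l y
    proof -
      have "(c * l + y)\<^sup>2 \<le> 2 * (c\<^sup>2 * l\<^sup>2) + 2 * y\<^sup>2"
        using sum_squares_ge_zero[of "c * l - y" 0] by (simp add: power2_eq_square algebra_simps)
      also have "c\<^sup>2 * l\<^sup>2 \<le> c\<^sup>2 * B" using that by (intro mult_left_mono) auto
      also have "c\<^sup>2 * B = B / S * (c\<^sup>2 * S)" using S by simp
      also have "\<dots> \<le> B / S * I" using cS B0 S by (intro mult_left_mono) auto
      also have "y\<^sup>2 \<le> K * I" using that(2) mult_left_mono[OF RI K] by linarith
      finally show ?thesis by (simp add: algebra_simps)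
    qed
    have "(poly L x)\<^sup>2 \<le> B" "(poly (pderiv L) x)\<^sup>2 \<le> B"
      using B[OF x] zero_le_power2[of "poly L x"] zero_le_power2[of "poly (pderiv L) x"] by linarith+
    with IH[OF r x] step[of "poly L x" "poly r x"] step[of "poly (pderiv L) x" "poly (pderiv r) x"]
    show ?thesis
      unfolding I_def[symmetric] R_def[symmetric]
      by (simp add: pr pderiv_add pderiv_smult)
  qed
  have "2 * B / S + 2 * K \<ge> 0" using B0 S K by simp
  with main show ?case by blast
qed

text \<open>The scaling to a cell of length \<open>h\<close> is stated without roots: \<open>|p|\<close> is bounded by
  \<open>h\<^bsup>-1/2\<^esup>\<close> and \<open>|p'|\<close> by \<open>h\<^bsup>-3/2\<^esup>\<close> times the \<open>L\<^sup>2\<close> norm, up to a constant.\<close>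

lemma inverse_estimate:
  obtains K :: real where "K > 0"
    and "\<And>a b (p :: real poly) x. a < b \<Longrightarrow> degree p \<le> k \<Longrightarrow> x \<in> {a..b} \<Longrightarrow>
           (b - a) * (poly p x)\<^sup>2 \<le> K * integral {a..b} (poly (p * p))"
    and "\<And>a b (p :: real poly) x. a < b \<Longrightarrow> degree p \<le> k \<Longrightarrow> x \<in> {a..b} \<Longrightarrow>
           (b - a) ^ 3 * (poly (pderiv p) x)\<^sup>2 \<le> K * integral {a..b} (poly (p * p))"
proof -
  obtain K where K: "K \<ge> 0"
    and ref: "\<And>(p :: real poly) x. \<forall>n\<ge>Suc k. coeff p n = 0 \<Longrightarrow> x \<in> {-1..1} \<Longrightarrow>
       (poly p x)\<^sup>2 \<le> K * integral {-1..1} (poly (p * p)) \<and>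
       (poly (pderiv p) x)\<^sup>2 \<le> K * integral {-1..1} (poly (p * p))"
    using inverse_estimate_ref[of "Suc k"] by meson
  \<comment> \<open>The summand 1 only makes the constant positive.\<close>
  have main: "(b - a) * (poly p x)\<^sup>2 \<le> (8 * K + 1) * integral {a..b} (poly (p * p)) \<and>
      (b - a) ^ 3 * (poly (pderiv p) x)\<^sup>2 \<le> (8 * K + 1) * integral {a..b} (poly (p * p))"
    if ab: "a < b" and p: "degree p \<le> k" and x: "x \<in> {a..b}" for a b :: real and p x
  proof -
    define \<Phi> where "\<Phi> = [:(a + b) / 2, (b - a) / 2:]"
    define q where "q = pcompose p \<Phi>"
    define y where "y = (2 * x - a - b) / (b - a)"
    have y: "y \<in> {-1..1}" and xy: "poly \<Phi> y = x" using ab x by (auto simp: y_def \<Phi>_def field_simps)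
    have "\<forall>n\<ge>Suc k. coeff q n = 0"
      using p degree_pcompose_le[of p \<Phi>] ab by (auto simp: q_def \<Phi>_def intro!: coeff_eq_0)
    from ref[OF this y] have est: "(poly q y)\<^sup>2 \<le> K * integral {-1..1} (poly (q * q))"
      "(poly (pderiv q) y)\<^sup>2 \<le> K * integral {-1..1} (poly (q * q))" by auto
    have int: "2 * integral {a..b} (poly (p * p)) = (b - a) * integral {-1..1} (poly (q * q))"
      using integral_affine[of a b "p * p"] ab by (simp add: q_def \<Phi>_def pcompose_mult del: poly_mult)
    have I0: "integral {a..b} (poly (p * p)) \<ge> 0" by (rule integral_poly_square_nonneg)
    have qy: "poly q y = poly p x" by (simp add: q_def poly_pcompose xy)
    have dqy: "poly (pderiv q) y = poly (pderiv p) x * ((b - a) / 2)"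
      by (simp add: q_def pderiv_pcompose poly_pcompose xy) (simp add: \<Phi>_def pderiv_pCons)
    have "(b - a) * (poly p x)\<^sup>2 \<le> (b - a) * (K * integral {-1..1} (poly (q * q)))"
      using est(1) ab unfolding qy by (intro mult_left_mono) auto
    also have "\<dots> = 2 * K * integral {a..b} (poly (p * p))" using int by simp
    also have "\<dots> \<le> (8 * K + 1) * integral {a..b} (poly (p * p))"
      using K I0 by (intro mult_right_mono) auto
    finally have 1: "(b - a) * (poly p x)\<^sup>2 \<le> (8 * K + 1) * integral {a..b} (poly (p * p))" .
    have "(b - a) ^ 3 * (poly (pderiv p) x)\<^sup>2 = 4 * (b - a) * (poly (pderiv q) y)\<^sup>2"
      unfolding dqy by (simp add: field_simps power2_eq_square power3_eq_cube)
    also have "\<dots> \<le> 4 * (b - a) * (K * integral {-1..1} (poly (q * q)))"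
      using est(2) ab by (intro mult_left_mono) auto
    also have "\<dots> = 4 * K * ((b - a) * integral {-1..1} (poly (q * q)))" by (simp add: mult_ac)
    also have "\<dots> = 8 * K * integral {a..b} (poly (p * p))" by (simp flip: int)
    also have "\<dots> \<le> (8 * K + 1) * integral {a..b} (poly (p * p))"
      using K I0 by (intro mult_right_mono) auto
    finally show ?thesis using 1 by simp
  qed
  show thesis
    by (rule that[of "8 * K + 1"]) (use K main in auto)
qed

section \<open>The transformation on one cell\<close>

lemma coeff_mult_bounded_degree:
  assumes "degree p \<le> m" "degree q \<le> n"
  shows "coeff (p * q) (m + n) = coeff p m * coeff q n"
proof -
  have "coeff (p * q) (m + n) = (\<Sum>i\<le>m + n. if i = m then coeff p m * coeff q n else 0)"
    unfolding coeff_mult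
  proof (intro sum.cong refl)
    fix i assume "i \<in> {..m + n}"
    then show "coeff p i * coeff q (m + n - i) = (if i = m then coeff p m * coeff q n else 0)"
      using assms by (cases i m rule: linorder_cases) (auto simp: coeff_eq_0)
  qed
  then show ?thesis by simp
qed

text \<open>The values \<open>c + \<Sum>\<^bsub>m\<le>j\<^esub> d m\<close> are those of a step function that starts at \<open>c\<close> and jumps by
  \<open>d j\<close>. Writing the result with all jumps \<open>0, \<dots>, k + 1\<close>, endpoints included, makes the last
  sum a complete quadrature sum.\<close>

lemma abel_summation:
  fixes F d :: "nat \<Rightarrow> real"
  shows "(\<Sum>j=0..k. (c + (\<Sum>m\<le>j. d m)) * (F (j + 1) - F j)) =
    (c + (\<Sum>m\<le>k + 1. d m)) * F (k + 1) - c * F 0 - (\<Sum>j\<le>k + 1. d j * F j)"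
  by (induction k) (simp_all add: algebra_simps)

locale sv_cell =
  fixes k :: nat and M :: sv_mesh and i :: nat
  assumes k: "k \<ge> 1"
    and faces_less: "face M (i - 1) < face M i"
    and ref_pts: "ref_points k (kind M i) (refpt M i)"
begin

abbreviation "lo \<equiv> face M (i - 1)"
abbreviation "hi \<equiv> face M i"

lemma pt_0: "pt M i 0 = lo" and pt_last: "pt M i (k + 1) = hi"
  using ref_pts by (simp_all add: pt_def ref_points_def cell_len_def field_simps)

lemma pt_less: "j < l \<Longrightarrow> l \<le> k + 1 \<Longrightarrow> pt M i j < pt M i l"
  using ref_points_strict_mono[OF ref_pts, of j l] faces_less by (simp add: pt_def cell_len_def)

lemma pt_mono: "j \<le> l \<Longrightarrow> l \<le> k + 1 \<Longrightarrow> pt M i j \<le> pt M i l"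
  using pt_less[of j l] by (cases "j = l") auto

lemma pt_in_cell: "j \<le> k + 1 \<Longrightarrow> pt M i j \<in> {lo..hi}"
  using pt_mono[of 0 j] pt_mono[of j "k + 1"] by (simp add: pt_0 pt_last del: One_nat_def add_Suc_right)

definition quad :: "(real \<Rightarrow> real) \<Rightarrow> real" where
  "quad f = (\<Sum>j\<le>k + 1. weight k M i j * f (pt M i j))"

lemma quad_exact:
  assumes "degree p < card (quad_idx k (kind M i)) + k"
  shows "integral {lo..hi} (poly p) = quad (poly p)"
proof -
  let ?\<Phi> = "[:(lo + hi) / 2, (hi - lo) / 2:]"
  have "degree (pcompose p ?\<Phi>) = degree p" using faces_less by (subst degree_pcompose) simp
  then have "integral {-1..1} (poly (pcompose p ?\<Phi>)) =
      (\<Sum>j\<le>k + 1. ref_weight k (kind M i) (refpt M i) j * poly (pcompose p ?\<Phi>) (refpt M i j))"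
    using assms by (intro ref_quadrature_exact[OF ref_pts k]) auto
  moreover have "poly ?\<Phi> (refpt M i j) = pt M i j" for j
    by (simp add: pt_def cell_len_def)
  ultimately show ?thesis
    using integral_affine[of lo hi p] faces_less
    unfolding quad_def
    by (simp only: poly_pcompose weight_def cell_len_def sum_distrib_left less_imp_le mult.assoc)
qed

lemma weight_nonneg: "0 \<le> weight k M i j"
  using ref_weight_nonneg[OF ref_pts, of j] faces_less by (simp add: weight_def cell_len_def)

lemma weight_sum: "(\<Sum>j\<le>k + 1. weight k M i j) = hi - lo"
proof -
  have "integral {lo..hi} (poly [:1:]) = quad (poly [:1:])"
    using k by (intro quad_exact) simp
  moreover have "integral {lo..hi} (poly [:1:]) = hi - lo"
    using integral_pderiv[of lo hi "[:0, 1:]"] faces_less by (simp add: pderiv_pCons)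
  ultimately show ?thesis by (simp add: quad_def)
qed

lemma weight_le:
  assumes "j \<le> k + 1" shows "weight k M i j \<le> hi - lo"
  unfolding weight_sum[symmetric] using assms weight_nonneg
  by (intro member_le_sum) auto

lemma sv_trans_eq:
  "sv_trans k M w i j = poly (w i) lo + (\<Sum>m\<le>j. weight k M i m * poly (pderiv (w i)) (pt M i m))"
  by (induction j) auto

text \<open>Exactness of the rule on \<open>w'\<close> identifies the value that the sum of all jumps leads to as the
  right endpoint value of \<open>w\<close>.\<close>

lemma sv_trans_summation_by_parts:
  assumes "degree (w i) \<le> k"
  shows "(\<Sum>j=0..k. sv_trans k M w i j * (F (j + 1) - F j)) =
    poly (w i) hi * F (k + 1) - poly (w i) lo * F 0
      - (\<Sum>j\<le>k + 1. weight k M i j * poly (pderiv (w i)) (pt M i j) * F j)"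
proof -
  have "integral {lo..hi} (poly (pderiv (w i))) = quad (poly (pderiv (w i)))"
    using k assms by (intro quad_exact) (cases "kind M i"; simp add: degree_pderiv)
  then have "poly (w i) lo + quad (poly (pderiv (w i))) = poly (w i) hi"
    using integral_pderiv[of lo hi "w i"] faces_less by simp
  then show ?thesis
    unfolding sv_trans_eq abel_summation by (simp only: quad_def)
qed

text \<open>The inner product \<open>(v, T w)\<close> on one cell, as a form in two polynomials so that its symmetry can
  be expressed.\<close>

definition cell_pairing :: "real poly \<Rightarrow> real poly \<Rightarrow> real" where
  "cell_pairing v w =
     (\<Sum>j=0..k. sv_trans k M (\<lambda>_. w) i j * integral {pt M i j..pt M i (j + 1)} (poly v))"

text \<open>The difference between the exact and the discrete integration by parts of \<open>P' w\<close>.\<close>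

lemma cell_pairing_eq_defect:
  assumes "degree w \<le> k" "pderiv P = v"
  shows "cell_pairing v w = integral {lo..hi} (poly (v * w)) +
    (integral {lo..hi} (poly (pderiv w * P)) - quad (poly (pderiv w * P)))"
proof -
  have "integral {pt M i j..pt M i (j + 1)} (poly v) = poly P (pt M i (j + 1)) - poly P (pt M i j)"
    if "j \<le> k" for j
    unfolding assms(2)[symmetric] using that by (intro integral_pderiv pt_mono) auto
  then have "cell_pairing v w =
      (\<Sum>j=0..k. sv_trans k M (\<lambda>_. w) i j * (poly P (pt M i (j + 1)) - poly P (pt M i j)))"
    unfolding cell_pairing_def by (intro sum.cong) auto
  also have "\<dots> = poly w hi * poly P hi - poly w lo * poly P lo - quad (poly (pderiv w * P))"
    using assms(1)
    by (subst sv_trans_summation_by_parts) (simp_all only: pt_0 pt_last quad_def poly_mult mult.assoc)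
  also have "poly w hi * poly P hi - poly w lo * poly P lo =
      integral {lo..hi} (poly (v * w)) + integral {lo..hi} (poly (pderiv w * P))"
    using integral_poly_by_parts[of lo hi P w] faces_less
    by (simp only: assms(2) mult.commute[of P "pderiv w"] less_imp_le)
       (simp add: mult.commute del: poly_mult)
  finally show ?thesis by (simp del: poly_mult)
qed

text \<open>By linearity and exactness below degree \<open>2k\<close>, this number determines the error of the rule on
  all polynomials of degree at most \<open>2k\<close>.\<close>

definition quad_defect :: real where
  "quad_defect = integral {lo..hi} (poly (monom 1 (2 * k))) - quad (poly (monom 1 (2 * k)))"

lemma quad_add: "quad (poly (p + q)) = quad (poly p) + quad (poly q)"
  and quad_smult: "quad (poly (smult c p)) = c * quad (poly p)"
  by (simp_all add: quad_def sum.distrib sum_distrib_left algebra_simps)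

lemma quad_error:
  assumes "degree p \<le> 2 * k"
  shows "integral {lo..hi} (poly p) - quad (poly p) = coeff p (2 * k) * quad_defect"
proof -
  define c r where "c = coeff p (2 * k)" and "r = p - smult c (monom 1 (2 * k))"
  have "degree r < 2 * k"
    using assms k by (intro degree_lessI) (auto simp: r_def c_def coeff_eq_0)
  moreover have "k \<le> card (quad_idx k (kind M i))" by (cases "kind M i") auto
  ultimately have "integral {lo..hi} (poly r) = quad (poly r)" by (intro quad_exact) simp
  moreover have p: "p = smult c (monom 1 (2 * k)) + r" by (simp add: r_def)
  have "integral {lo..hi} (poly p) = c * integral {lo..hi} (poly (monom 1 (2 * k))) + integral {lo..hi} (poly r)"
    "quad (poly p) = c * quad (poly (monom 1 (2 * k))) + quad (poly r)"
    by (subst p, simp only: integral_poly_add integral_poly_smult quad_add quad_smult)+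
  ultimately show ?thesis
    by (simp only: quad_defect_def flip: c_def) (simp only: right_diff_distrib)
qed

lemma quad_defect_Radau: "kind M i \<noteq> Gauss \<Longrightarrow> quad_defect = 0"
  unfolding quad_defect_def
  by (subst quad_exact) (cases "kind M i"; simp add: degree_monom_eq)+

text \<open>For Gauss points the rule annihilates the square of the monic node polynomial \<open>W\<close>, so its
  error on \<open>W\<^sup>2\<close>, which is the defect, equals \<open>\<integral> W\<^sup>2\<close>.\<close>

lemma quad_defect_nonneg: "0 \<le> quad_defect"
proof (cases "kind M i = Gauss")
  case True
  define W where "W = (\<Prod>j\<in>{1..k}. [:- pt M i j, 1:])"
  have degW: "degree W = k" unfolding W_def by (subst degree_prod_eq_sum_degree) auto
  have "lead_coeff W = 1" unfolding W_def by (simp add: lead_coeff_prod)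
  then have W: "coeff (W * W) (2 * k) = 1" "degree (W * W) \<le> 2 * k"
    using coeff_mult_bounded_degree[of W k W k] degree_mult_le[of W W] degW by (simp_all add: mult_2)
  have "weight k M i j * poly (W * W) (pt M i j) = 0" if "j \<le> k + 1" for j
  proof (cases "j \<in> {1..k}")
    case True
    then have "poly W (pt M i j) = 0" unfolding W_def poly_prod by (intro prod_zero) auto
    then show ?thesis by simp
  next
    case False
    then show ?thesis using \<open>kind M i = Gauss\<close> by (auto simp: weight_def ref_weight_def)
  qed
  then have "quad (poly (W * W)) = 0" unfolding quad_def by (intro sum.neutral) auto
  then show ?thesis
    using quad_error[OF W(2)] W(1) integral_poly_square_nonneg[of lo hi W] by simp
qed (simp add: quad_defect_Radau)

text \<open>The coefficient of \<open>x\<^bsup>2k\<^esup>\<close> in \<open>w' P\<close> is \<open>k w\<^sub>k v\<^sub>k / (k + 1)\<close>, where \<open>P\<close> is a primitive of \<open>v\<close>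
  and \<open>v\<^sub>k, w\<^sub>k\<close> are the coefficients of \<open>x\<^sup>k\<close>; symmetry and positivity can be read off.\<close>

lemma cell_pairing_eq:
  assumes "degree v \<le> k" "degree w \<le> k"
  shows "cell_pairing v w = integral {lo..hi} (poly (v * w)) +
    quad_defect * (k / (k + 1)) * coeff v k * coeff w k"
proof -
  let ?P = "primitive v"
  have dP: "degree ?P \<le> k + 1" using degree_primitive[of v] assms by simp
  have dw: "degree (pderiv w) \<le> k - 1" using assms by (simp add: degree_pderiv)
  \<comment> \<open>The degrees of \<open>w'\<close> and of the primitive of \<open>v\<close> add up to at most \<open>2k\<close>.\<close>
  have sum: "2 * k = (k - 1) + (k + 1)" using k by simp
  have "degree (pderiv w * ?P) \<le> 2 * k"
    unfolding sum by (rule order.trans[OF degree_mult_le add_mono[OF dw dP]])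
  moreover have "coeff (pderiv w * ?P) (2 * k) = (k * coeff w k) * (coeff v k / (k + 1))"
    unfolding sum coeff_mult_bounded_degree[OF dw dP]
    using k by (simp add: coeff_primitive_Suc coeff_pderiv)
  ultimately have "integral {lo..hi} (poly (pderiv w * ?P)) - quad (poly (pderiv w * ?P)) =
      (k * coeff w k) * (coeff v k / (k + 1)) * quad_defect"
    using quad_error[of "pderiv w * ?P"] by (simp only:)
  also have "\<dots> = quad_defect * (k / (k + 1)) * coeff v k * coeff w k" by simp
  finally show ?thesis
    using cell_pairing_eq_defect[OF assms(2) pderiv_primitive[of v]] by (simp only:)
qed

lemma cell_pairing_commute:
  "degree v \<le> k \<Longrightarrow> degree w \<le> k \<Longrightarrow> cell_pairing v w = cell_pairing w v"
  by (simp add: cell_pairing_eq mult_ac)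

lemma cell_pairing_ge:
  assumes "degree v \<le> k"
  shows "integral {lo..hi} (poly (v * v)) \<le> cell_pairing v v"
  using quad_defect_nonneg by (simp add: cell_pairing_eq[OF assms assms] mult.assoc)

lemma cell_pairing_Radau:
  assumes "degree v \<le> k" "kind M i \<noteq> Gauss"
  shows "cell_pairing v v = integral {lo..hi} (poly (v * v))"
  using quad_defect_Radau[OF assms(2)] by (simp add: cell_pairing_eq[OF assms(1,1)])

end

section \<open>The flux form on one cell\<close>

text \<open>The powers of \<open>h\<close> match those in the inverse estimates, with \<open>d\<close> the value of a derivative.\<close>

lemma young_scaled:
  fixes h d y :: real
  assumes "h > 0"
  shows "h\<^sup>2 * \<bar>d * y\<bar> \<le> (h ^ 3 * d\<^sup>2 + h * y\<^sup>2) / 2"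
proof -
  have "0 \<le> h * (h * \<bar>d\<bar> - \<bar>y\<bar>)\<^sup>2" using assms by simp
  also have "\<dots> = h ^ 3 * d\<^sup>2 + h * y\<^sup>2 - 2 * (h\<^sup>2 * \<bar>d * y\<bar>)"
    by (simp add: power2_diff abs_mult power_mult_distrib algebra_simps power2_eq_square power3_eq_cube)
  finally show ?thesis by simp
qed

text \<open>Here \<open>w\<close> is a quadrature weight, \<open>c\<close> the velocity at an endpoint close to one of its zeros,
  \<open>d\<close> and \<open>z\<close> the derivative and the value from inside the cell, and \<open>y\<close> the value from the
  neighbouring cell.\<close>

lemma endpoint_correction_bound:
  fixes h w d c y z A E Y :: real
  assumes h: "h > 0" and w: "0 \<le> w" "w \<le> h" and c: "\<bar>c\<bar> \<le> A * h"
    and d: "h ^ 3 * d\<^sup>2 \<le> E" and z: "h * z\<^sup>2 \<le> E" and y: "h * y\<^sup>2 \<le> Y"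
  shows "\<bar>w * d * (c * (y - z))\<bar> \<le> A * (3 / 2 * E + Y / 2)"
proof -
  have "0 \<le> A * h" using c by (rule order.trans[OF abs_ge_zero])
  then have A: "A \<ge> 0" using h by (simp add: zero_le_mult_iff)
  have "\<bar>w * d * (c * (y - z))\<bar> = (w * \<bar>c\<bar>) * \<bar>d * (y - z)\<bar>" using w by (simp add: abs_mult)
  also have "\<dots> \<le> (h * (A * h)) * (\<bar>d * y\<bar> + \<bar>d * z\<bar>)"
    using w c h A by (intro mult_mono) (auto simp: right_diff_distrib)
  also have "\<dots> = A * (h\<^sup>2 * \<bar>d * y\<bar> + h\<^sup>2 * \<bar>d * z\<bar>)" by (simp add: algebra_simps power2_eq_square)
  also have "\<dots> \<le> A * (3 / 2 * E + Y / 2)"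
    using young_scaled[OF h, of d y] young_scaled[OF h, of d z] d y z A by (intro mult_left_mono) auto
  finally show ?thesis .
qed

context sv_cell
begin

text \<open>On \<open>p p'\<close> alone, of degree \<open>2k - 1\<close>, the rule is exact. With the velocity frozen at the left
  endpoint only \<open>(\<alpha> - \<alpha>(lo)) p p'\<close> contributes, to which integral and quadrature each respond with
  at most \<open>A E\<close>.\<close>

lemma quad_product_error:
  assumes p: "degree p \<le> k"
    and inv: "\<And>x. x \<in> {lo..hi} \<Longrightarrow> (hi - lo) * (poly p x)\<^sup>2 \<le> E"
             "\<And>x. x \<in> {lo..hi} \<Longrightarrow> (hi - lo) ^ 3 * (poly (pderiv p) x)\<^sup>2 \<le> E"
    and cont: "continuous_on {lo..hi} \<alpha>"
    and lip: "\<And>x y. x \<in> {lo..hi} \<Longrightarrow> y \<in> {lo..hi} \<Longrightarrow> \<bar>\<alpha> x - \<alpha> y\<bar> \<le> A * \<bar>x - y\<bar>"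
    and A: "A \<ge> 0"
  shows "\<bar>quad (\<lambda>x. \<alpha> x * (poly p x * poly (pderiv p) x)) -
          integral {lo..hi} (\<lambda>x. \<alpha> x * (poly p x * poly (pderiv p) x))\<bar> \<le> 2 * A * E"
proof -
  define h where "h = hi - lo"
  have h: "h > 0" using faces_less by (simp add: h_def)
  define q where "q = p * pderiv p"
  define e where "e x = (\<alpha> x - \<alpha> lo) * poly q x" for x
  have split: "\<alpha> x * (poly p x * poly (pderiv p) x) = e x + \<alpha> lo * poly q x" for x
    by (simp add: e_def q_def algebra_simps)
  have e_bound: "\<bar>e x\<bar> \<le> A * E / h" if x: "x \<in> {lo..hi}" for x
  proof -
    have E0: "h\<^sup>2 * \<bar>poly q x\<bar> \<le> E"
      using young_scaled[OF h, of "poly (pderiv p) x" "poly p x"] inv[OF x]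
      by (simp add: q_def h_def mult.commute[of "poly p x"])
    have "\<bar>\<alpha> x - \<alpha> lo\<bar> \<le> A * \<bar>x - lo\<bar>" using x faces_less by (intro lip) auto
    also have "\<dots> \<le> A * h" using x A by (intro mult_left_mono) (auto simp: h_def)
    finally have "\<bar>e x\<bar> \<le> A * h * \<bar>poly q x\<bar>"
      unfolding e_def abs_mult by (rule mult_right_mono) simp
    also have "\<dots> = A * (h\<^sup>2 * \<bar>poly q x\<bar>) / h" using h by (simp add: power2_eq_square)
    also have "\<dots> \<le> A * E / h" using E0 A h by (intro divide_right_mono mult_left_mono) auto
    finally show ?thesis .
  qed
  have cont_e: "continuous_on {lo..hi} e"
    unfolding e_def by (intro continuous_intros cont)
  have "degree q \<le> k + (k - 1)"
    unfolding q_def using p by (intro order.trans[OF degree_mult_le] add_mono) (auto simp: degree_pderiv)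
  then have "integral {lo..hi} (poly q) = quad (poly q)"
    using k by (intro quad_exact) (cases "kind M i"; simp)
  moreover have "quad (\<lambda>x. \<alpha> x * (poly p x * poly (pderiv p) x)) = quad e + \<alpha> lo * quad (poly q)"
    unfolding quad_def split by (simp add: sum.distrib sum_distrib_left algebra_simps)
  moreover have "integral {lo..hi} (\<lambda>x. \<alpha> x * (poly p x * poly (pderiv p) x)) =
      integral {lo..hi} e + \<alpha> lo * integral {lo..hi} (poly q)"
    unfolding split using cont_e
    by (subst integral_add) (auto intro!: integrable_continuous_interval continuous_intros)
  moreover have "\<bar>quad e\<bar> \<le> A * E"
  proof -
    have "\<bar>quad e\<bar> \<le> (\<Sum>j\<le>k + 1. weight k M i j * (A * E / h))"
      unfolding quad_def
    proof (intro sum_abs[THEN order.trans] sum_mono)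
      fix j assume "j \<in> {..k + 1}"
      then show "\<bar>weight k M i j * e (pt M i j)\<bar> \<le> weight k M i j * (A * E / h)"
        using e_bound[OF pt_in_cell, of j] weight_nonneg[of j]
        unfolding abs_mult abs_of_nonneg[OF weight_nonneg] by (intro mult_left_mono) auto
    qed
    also have "\<dots> = A * E" unfolding sum_distrib_right[symmetric] weight_sum using h by (simp add: h_def)
    finally show ?thesis .
  qed
  moreover have "\<bar>integral {lo..hi} e\<bar> \<le> A * E"
    using integral_bound[OF _ cont_e, of "A * E / h"] e_bound h faces_less by (simp add: h_def)
  moreover have "\<bar>a - b\<bar> \<le> 2 * A * E"
    if "r = s" "a = x + c * s" "b = y + c * r" "\<bar>x\<bar> \<le> A * E" "\<bar>y\<bar> \<le> A * E" for a b c r s x y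
    using that by (simp add: abs_if split: if_splits)
  ultimately show ?thesis by blast
qed

lemma integral_advection:
  assumes "\<And>x. x \<in> {lo..hi} \<Longrightarrow> (\<alpha> has_real_derivative \<alpha>' x) (at x)"
    and "continuous_on {lo..hi} \<alpha>'"
  shows "integral {lo..hi} (\<lambda>x. \<alpha> x * (poly p x * poly (pderiv p) x)) =
    (\<alpha> hi * (poly p hi)\<^sup>2 - \<alpha> lo * (poly p lo)\<^sup>2) / 2
      - integral {lo..hi} (\<lambda>x. \<alpha>' x * poly p x * poly p x) / 2"
proof -
  have cont: "continuous_on {lo..hi} \<alpha>"
    using assms(1) by (intro continuous_at_imp_continuous_on ballI DERIV_isCont)
  have deriv: "((\<lambda>x. \<alpha> x * (poly p x)\<^sup>2) has_real_derivative
      \<alpha>' x * poly p x * poly p x + 2 * (\<alpha> x * (poly p x * poly (pderiv p) x))) (at x within {lo..hi})"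
    if "x \<in> {lo..hi}" for x
    unfolding power2_eq_square
    by (rule DERIV_cong[OF DERIV_mult[OF has_field_derivative_at_within[OF assms(1)[OF that]]
          DERIV_mult[OF has_field_derivative_at_within[OF poly_DERIV] has_field_derivative_at_within[OF poly_DERIV]]]])
       (simp add: algebra_simps)
  have "((\<lambda>x. \<alpha>' x * poly p x * poly p x + 2 * (\<alpha> x * (poly p x * poly (pderiv p) x))) has_integral
      (\<alpha> hi * (poly p hi)\<^sup>2 - \<alpha> lo * (poly p lo)\<^sup>2)) {lo..hi}"
    using faces_less deriv
    by (intro fundamental_theorem_of_calculus)
       (simp_all flip: has_real_derivative_iff_has_vector_derivative)
  then have "integral {lo..hi} (\<lambda>x. \<alpha>' x * poly p x * poly p x + 2 * (\<alpha> x * (poly p x * poly (pderiv p) x))) =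
      \<alpha> hi * (poly p hi)\<^sup>2 - \<alpha> lo * (poly p lo)\<^sup>2"
    by (rule integral_unique)
  moreover have "(\<lambda>x. \<alpha>' x * poly p x * poly p x) integrable_on {lo..hi}"
    "(\<lambda>x. 2 * (\<alpha> x * (poly p x * poly (pderiv p) x))) integrable_on {lo..hi}"
    using assms(2) cont by (auto intro!: integrable_continuous_interval continuous_intros)
  note integral_add[OF this]
  moreover have "x = r / 2 - y / 2" if "z = r" "z = y + 2 * x" for x y z r :: real
    using that by simp
  ultimately show ?thesis unfolding integral_mult_right by blast
qed

text \<open>Here \<open>E\<close>, \<open>X\<close> and \<open>Y\<close> stand for the squared \<open>L\<^sup>2\<close> norms on the cell and on its left and right
  neighbours, up to the constants of the inverse estimate and of shape regularity.

  The quadrature sum of the summation by parts contains the upwind values at the endpoints instead of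
  the values of \<open>p\<close>; \<open>L\<close> and \<open>R\<close> are the resulting corrections. If \<open>R\<close> does not vanish, the right
  endpoint carries weight, so the points are right Radau, and the velocity there is negative, so that
  the upwind value comes from the right neighbour. Right Radau points are excluded when the velocity
  is negative at both endpoints, hence it changes sign in the cell and is at most \<open>A h\<close>. The left
  endpoint is the mirror image.\<close>

lemma cell_flux_lower_bound:
  fixes v :: broken_poly
  defines "p \<equiv> v i"
  assumes i: "i \<in> {1..cells M}"
    and p: "degree p \<le> k"
    and choice: "point_choice meth \<alpha> M i"
    and inv: "\<And>x. x \<in> {lo..hi} \<Longrightarrow> (hi - lo) * (poly p x)\<^sup>2 \<le> E"
             "\<And>x. x \<in> {lo..hi} \<Longrightarrow> (hi - lo) ^ 3 * (poly (pderiv p) x)\<^sup>2 \<le> E"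
    and X: "(hi - lo) * (left_lim M v (i - 1))\<^sup>2 \<le> X"
    and Y: "(hi - lo) * (right_lim M v i)\<^sup>2 \<le> Y"
    and deriv: "\<And>x. x \<in> {lo..hi} \<Longrightarrow> (\<alpha> has_real_derivative \<alpha>' x) (at x)"
    and cont': "continuous_on {lo..hi} \<alpha>'"
    and lip: "\<And>x y. x \<in> {lo..hi} \<Longrightarrow> y \<in> {lo..hi} \<Longrightarrow> \<bar>\<alpha> x - \<alpha> y\<bar> \<le> A * \<bar>x - y\<bar>"
    and A: "A \<ge> 0"
  shows "\<alpha> hi * (poly p hi * upwind M \<alpha> v i - (poly p hi)\<^sup>2 / 2)
      - \<alpha> lo * (poly p lo * upwind M \<alpha> v (i - 1) - (poly p lo)\<^sup>2 / 2)
      + integral {lo..hi} (\<lambda>x. \<alpha>' x * poly p x * poly p x) / 2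
      - A * (5 * E + (X + Y) / 2)
    \<le> (\<Sum>j=0..k. sv_trans k M v i j * (flux k M \<alpha> v i (j + 1) - flux k M \<alpha> v i j))"
proof -
  define h where "h = hi - lo"
  have h: "h > 0" using faces_less by (simp add: h_def)
  have ends: "lo \<in> {lo..hi}" "hi \<in> {lo..hi}" using faces_less by auto
  have X0: "X \<ge> 0" and Y0: "Y \<ge> 0" and E0: "E \<ge> 0"
    using h by (intro order.trans[OF _ X] order.trans[OF _ Y] order.trans[OF _ inv(1)[OF ends(1)]]; simp add: h_def)+
  have left_i: "left_lim M v i = poly p hi" using i by (auto simp: left_lim_def p_def Let_def)
  have right_i: "right_lim M v (i - 1) = poly p lo" using i by (auto simp: right_lim_def p_def Let_def)
  define d where "d x = poly (pderiv p) x" for x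
  define U V where "U = upwind M \<alpha> v (i - 1)" and "V = upwind M \<alpha> v i"
  define L R where "L = weight k M i 0 * d lo * (\<alpha> lo * (U - poly p lo))"
    and "R = weight k M i (k + 1) * d hi * (\<alpha> hi * (V - poly p hi))"
  let ?F = "flux k M \<alpha> v i"
  have F0: "?F 0 = \<alpha> lo * U" unfolding flux_def pt_0 by (simp add: U_def)
  have F1: "?F (k + 1) = \<alpha> hi * V" unfolding flux_def pt_last by (simp add: V_def)
  have "weight k M i j * d (pt M i j) * ?F j =
      weight k M i j * (\<alpha> (pt M i j) * (poly p (pt M i j) * d (pt M i j))) +
      ((if j = 0 then L else 0) + (if j = k + 1 then R else 0))" if "j \<le> k + 1" for j
  proof -
    consider "j = 0" | "j = k + 1" | "j \<noteq> 0" "j \<noteq> k + 1" by blast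
    then show ?thesis
    proof cases
      case 1
      then show ?thesis by (simp only: F0 pt_0 L_def) (simp add: algebra_simps)
    next
      case 2
      then show ?thesis by (simp only: F1 pt_last R_def) (simp add: algebra_simps)
    next
      case 3
      then show ?thesis by (simp add: flux_def p_def)
    qed
  qed
  then have "(\<Sum>j\<le>k + 1. weight k M i j * d (pt M i j) * ?F j) =
      (\<Sum>j\<le>k + 1. weight k M i j * (\<alpha> (pt M i j) * (poly p (pt M i j) * d (pt M i j))) +
        ((if j = 0 then L else 0) + (if j = k + 1 then R else 0)))"
    by (intro sum.cong) auto
  also have "\<dots> = quad (\<lambda>x. \<alpha> x * (poly p x * d x)) + L + R"
    unfolding sum.distrib quad_def by (simp del: sum.atMost_Suc)
  finally have sum: "(\<Sum>j=0..k. sv_trans k M v i j * (?F (j + 1) - ?F j)) =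
      poly p hi * (\<alpha> hi * V) - poly p lo * (\<alpha> lo * U) - (quad (\<lambda>x. \<alpha> x * (poly p x * d x)) + L + R)"
    using p unfolding p_def d_def by (subst sv_trans_summation_by_parts) (simp_all only: F0 F1)
  have cont: "continuous_on {lo..hi} \<alpha>"
    using deriv by (intro continuous_at_imp_continuous_on ballI DERIV_isCont)
  have Q: "quad (\<lambda>x. \<alpha> x * (poly p x * d x)) \<le>
      (\<alpha> hi * (poly p hi)\<^sup>2 - \<alpha> lo * (poly p lo)\<^sup>2) / 2
      - integral {lo..hi} (\<lambda>x. \<alpha>' x * poly p x * poly p x) / 2 + 2 * A * E"
  proof -
    have le: "x \<le> r + e" if "\<bar>x - y\<bar> \<le> e" "y = r" for x y r e :: real
      using that by simp
    show ?thesis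
      unfolding d_def by (rule le[OF quad_product_error[OF p inv cont lip A] integral_advection[OF deriv cont']])
  qed
  have lip_ends: "\<bar>\<alpha> hi - \<alpha> lo\<bar> \<le> A * h" using lip[OF ends(2,1)] h by (simp add: h_def)
  have pos: "0 \<le> A * (3 / 2 * E + X / 2)" "0 \<le> A * (3 / 2 * E + Y / 2)"
    using A X0 Y0 E0 by auto
  have R: "\<bar>R\<bar> \<le> A * (3 / 2 * E + Y / 2)"
  proof (cases "\<alpha> hi < 0 \<and> k + 1 \<in> quad_idx k (kind M i)")
    case True
    then have "kind M i = Right_Radau" by (cases "kind M i") auto
    then have "\<alpha> lo \<ge> 0" using choice True by (cases meth) auto
    then have "\<bar>\<alpha> hi\<bar> \<le> A * h" using lip_ends True by linarith
    moreover have "V = right_lim M v i" using True by (simp add: V_def upwind_def)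
    ultimately show ?thesis
      unfolding R_def using h weight_nonneg weight_le[of "k + 1"] inv[OF ends(2)] Y
      by (intro endpoint_correction_bound[of h]) (simp_all add: h_def d_def)
  next
    case False
    then have "R = 0"
      by (cases "\<alpha> hi = 0") (auto simp: R_def V_def upwind_def left_i weight_def ref_weight_def)
    then show ?thesis using pos by simp
  qed
  have L: "\<bar>L\<bar> \<le> A * (3 / 2 * E + X / 2)"
  proof (cases "\<alpha> lo > 0 \<and> 0 \<in> quad_idx k (kind M i)")
    case True
    then have "kind M i = Left_Radau" by (cases "kind M i") auto
    then have "\<alpha> hi \<le> 0" using choice True by (cases meth) auto
    then have "\<bar>\<alpha> lo\<bar> \<le> A * h" using lip_ends True by linarith
    moreover have "U = left_lim M v (i - 1)" using True by (simp add: U_def upwind_def)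
    ultimately show ?thesis
      unfolding L_def using h weight_nonneg weight_le[of 0] inv[OF ends(1)] X
      by (intro endpoint_correction_bound[of h]) (simp_all add: h_def d_def)
  next
    case False
    then have "L = 0"
      using right_i by (auto simp: L_def U_def upwind_def weight_def ref_weight_def)
    then show ?thesis using pos by simp
  qed
  \<comment> \<open>Pure algebra, for arbitrary numbers in place of the values on the cell.\<close>
  have combine: "b * (y * V' - y\<^sup>2 / 2) - a * (x * U' - x\<^sup>2 / 2) + I / 2 - A * (5 * E + (X + Y) / 2)
      \<le> y * (b * V') - x * (a * U') - (q + l + r)"
    if "q \<le> (b * y\<^sup>2 - a * x\<^sup>2) / 2 - I / 2 + 2 * A * E"
      "\<bar>l\<bar> \<le> A * (3 / 2 * E + X / 2)" "\<bar>r\<bar> \<le> A * (3 / 2 * E + Y / 2)" for a b x y I q l r U' V' :: real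
  proof -
    have "l \<le> A * (3 / 2 * E + X / 2)" "r \<le> A * (3 / 2 * E + Y / 2)" using that by auto
    with that(1) show ?thesis by (simp add: field_simps)
  qed
  show ?thesis
    unfolding sum U_def[symmetric] V_def[symmetric] by (rule combine[OF Q L R])
qed

end

section \<open>The flux form on the mesh\<close>

lemma sum_shift_periodic:
  fixes f :: "nat \<Rightarrow> real"
  assumes "f 0 = f N"
  shows "(\<Sum>i=1..N. f (i - 1)) = (\<Sum>i=1..N. f i)"
proof -
  have "(\<Sum>i=1..N. f i - f (i - 1)) = f N - f 0" by (induction N) auto
  then show ?thesis using assms by (simp add: sum_subtractf)
qed

text \<open>The sum over the cells of the bounds from \<open>cell_flux_lower_bound\<close>, sorted by terms.\<close>

lemma cell_bounds_sum:
  fixes a b I n l r :: "'i \<Rightarrow> real"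
  shows "(\<Sum>i\<in>S. a i - b i + I i / 2 - A * (5 * (K * n i) + (s * l i + s * r i) / 2)) =
    sum a S - sum b S + sum I S / 2 - A * (5 * (K * sum n S) + (s * sum l S + s * sum r S) / 2)"
  by (induction S rule: infinite_finite_induct) (simp_all add: field_simps)

text \<open>The difference is half of \<open>|\<alpha>|\<close> times the squared jump, whichever side the upwind value comes
  from.\<close>

lemma upwind_dissipation:
  "0 \<le> \<alpha> (face M j) * (left_lim M v j * upwind M \<alpha> v j - (left_lim M v j)\<^sup>2 / 2)
     - \<alpha> (face M j) * (right_lim M v j * upwind M \<alpha> v j - (right_lim M v j)\<^sup>2 / 2)"
proof -
  have eq: "\<alpha> (face M j) * (left_lim M v j * upwind M \<alpha> v j - (left_lim M v j)\<^sup>2 / 2)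
     - \<alpha> (face M j) * (right_lim M v j * upwind M \<alpha> v j - (right_lim M v j)\<^sup>2 / 2)
    = \<bar>\<alpha> (face M j)\<bar> / 2 * (left_lim M v j - right_lim M v j)\<^sup>2"
    by (auto simp: upwind_def power2_eq_square algebra_simps abs_if)
  show ?thesis unfolding eq by simp
qed

lemma admissible_cells_pos: "admissible_mesh meth k \<sigma> \<alpha> M \<Longrightarrow> cells M > 0"
  by (rule gr0I) (auto simp: admissible_mesh_def)

lemma admissible_sv_cell:
  assumes "admissible_mesh meth k \<sigma> \<alpha> M" "k \<ge> 1" "i \<in> {1..cells M}"
  shows "sv_cell k M i"
proof -
  have "i - 1 < cells M" "i - 1 + 1 = i" using assms(3) by auto
  then show ?thesis using assms unfolding admissible_mesh_def sv_cell_def by metis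
qed

lemma admissible_faces_mono:
  assumes "admissible_mesh meth k \<sigma> \<alpha> M" "i \<le> j" "j \<le> cells M"
  shows "face M i \<le> face M j"
  using assms(2,3)
proof (induction j)
  case (Suc j)
  then have "face M j < face M (Suc j)" using assms(1) by (auto simp: admissible_mesh_def)
  then show ?case using Suc by (cases "i = Suc j") auto
qed simp

lemma admissible_cell_subset:
  assumes "admissible_mesh meth k \<sigma> \<alpha> M" "i \<in> {1..cells M}"
  shows "{face M (i - 1)..face M i} \<subseteq> {0..2 * pi}"
  using admissible_faces_mono[OF assms(1), of 0 "i - 1"] admissible_faces_mono[OF assms(1), of i "cells M"]
    assms by (auto simp: admissible_mesh_def)

lemma admissible_len_le:
  assumes "admissible_mesh meth k \<sigma> \<alpha> M" "i \<in> {1..cells M}" "l \<in> {1..cells M}"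
  shows "cell_len M i \<le> \<sigma> * cell_len M l"
proof -
  have "cell_len M i \<le> mesh_size M" unfolding mesh_size_def using assms by (intro Max_ge) auto
  also have "\<dots> \<le> \<sigma> * cell_len M l" using assms by (auto simp: admissible_mesh_def)
  finally show ?thesis .
qed

lemma admissible_shape_pos:
  assumes "admissible_mesh meth k \<sigma> \<alpha> M" "k \<ge> 1" shows "\<sigma> > 0"
proof -
  have 1: "1 \<in> {1..cells M}" using admissible_cells_pos[OF assms(1)] by simp
  have "0 < cell_len M 1"
    using sv_cell.faces_less[OF admissible_sv_cell[OF assms 1]] by (simp add: cell_len_def)
  with admissible_len_le[OF assms(1) 1 1] show ?thesis
    by (metis order.strict_trans2 zero_less_mult_pos2)
qed

lemma L2_norm_square:
  "(L2_norm M v)\<^sup>2 = (\<Sum>i=1..cells M. integral {face M (i - 1)..face M i} (poly (v i * v i)))"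
  and L2_norm_nonneg: "0 \<le> L2_norm M v"
proof -
  have "L2_weighted M (\<lambda>_. 1) v v = (\<Sum>i=1..cells M. integral {face M (i - 1)..face M i} (poly (v i * v i)))"
    unfolding L2_weighted_def by (intro sum.cong) (auto simp: poly_mult[abs_def])
  moreover have "0 \<le> \<dots>" by (intro sum_nonneg integral_poly_square_nonneg)
  ultimately show "(L2_norm M v)\<^sup>2 = (\<Sum>i=1..cells M. integral {face M (i - 1)..face M i} (poly (v i * v i)))"
    "0 \<le> L2_norm M v"
    by (simp_all add: L2_norm_def)
qed

lemma flux_form_lower_bound:
  assumes mesh: "admissible_mesh meth k \<sigma> \<alpha> M" and k: "k \<ge> 1" and v: "v \<in> Vh k M"
    and \<alpha>: "periodic \<alpha>" "\<And>x. (\<alpha> has_real_derivative \<alpha>' x) (at x)" "continuous_on {0..2 * pi} \<alpha>'"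
    and A: "\<And>x. x \<in> {0..2 * pi} \<Longrightarrow> \<bar>\<alpha>' x\<bar> \<le> A"
    and inv: "\<And>a b (p :: real poly) x. a < b \<Longrightarrow> degree p \<le> k \<Longrightarrow> x \<in> {a..b} \<Longrightarrow>
                (b - a) * (poly p x)\<^sup>2 \<le> K * integral {a..b} (poly (p * p))"
             "\<And>a b (p :: real poly) x. a < b \<Longrightarrow> degree p \<le> k \<Longrightarrow> x \<in> {a..b} \<Longrightarrow>
                (b - a) ^ 3 * (poly (pderiv p) x)\<^sup>2 \<le> K * integral {a..b} (poly (p * p))"
  shows "L2_weighted M \<alpha>' v v / 2 - A * K * (5 + \<sigma>) * (L2_norm M v)\<^sup>2 \<le>
    (\<Sum>i=1..cells M. \<Sum>j=0..k. sv_trans k M v i j * (flux k M \<alpha> v i (j + 1) - flux k M \<alpha> v i j))"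
proof -
  define N where "N = cells M"
  have N: "N > 0" using admissible_cells_pos[OF mesh] by (simp add: N_def)
  have A0: "A \<ge> 0" using A[of 0] by (auto intro: order.trans[OF abs_ge_zero])
  have lip: "\<bar>\<alpha> x - \<alpha> y\<bar> \<le> A * \<bar>x - y\<bar>" if "x \<in> {0..2 * pi}" "y \<in> {0..2 * pi}" for x y
    using field_differentiable_bound[of "{0..2 * pi}" \<alpha> \<alpha>' A x y] that A \<alpha>(2)
    by (auto intro: has_field_derivative_at_within)
  define n where "n i = integral {face M (i - 1)..face M i} (poly (v i * v i))" for i
  \<comment> \<open>Squared norms on the cells to the left and to the right of face \<open>j\<close>, with the two ends of the domain identified.\<close>
  define nl nr where "nl j = n (if j = 0 then N else j)" and "nr j = n ((if j = N then 0 else j) + 1)" for j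
  \<comment> \<open>Contributions of face \<open>j\<close> to the bounds on the cells to its left and to its right.\<close>
  define gl gr where "gl j = \<alpha> (face M j) * (left_lim M v j * upwind M \<alpha> v j - (left_lim M v j)\<^sup>2 / 2)"
    and "gr j = \<alpha> (face M j) * (right_lim M v j * upwind M \<alpha> v j - (right_lim M v j)\<^sup>2 / 2)" for j
  have face_bound: "(face M i - face M (i - 1)) * (poly (v l) (face M j))\<^sup>2 \<le> \<sigma> * K * n l"
    if i: "i \<in> {1..N}" and l: "l \<in> {1..N}" and j: "j = l \<or> j = l - 1" for i l j
  proof -
    have "face M (l - 1) < face M l"
      using sv_cell.faces_less[OF admissible_sv_cell[OF mesh k]] l by (simp add: N_def)
    then have l_bound: "cell_len M l * (poly (v l) (face M j))\<^sup>2 \<le> K * n l"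
      unfolding n_def cell_len_def using v l j by (intro inv(1)) (auto simp: Vh_def N_def)
    have "cell_len M i \<le> \<sigma> * cell_len M l" using admissible_len_le[OF mesh] i l by (simp add: N_def)
    then have "cell_len M i * (poly (v l) (face M j))\<^sup>2 \<le> \<sigma> * cell_len M l * (poly (v l) (face M j))\<^sup>2"
      by (rule mult_right_mono) simp
    also have "\<dots> \<le> \<sigma> * (K * n l)"
      using mult_left_mono[OF l_bound, of \<sigma>] admissible_shape_pos[OF mesh k] by (simp add: mult.assoc)
    finally show ?thesis by (simp add: cell_len_def mult.assoc)
  qed
  have cell: "gl i - gr (i - 1) + integral {face M (i - 1)..face M i} (\<lambda>x. \<alpha>' x * poly (v i) x * poly (v i) x) / 2
      - A * (5 * (K * n i) + (\<sigma> * K * nl (i - 1) + \<sigma> * K * nr i) / 2)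
      \<le> (\<Sum>j=0..k. sv_trans k M v i j * (flux k M \<alpha> v i (j + 1) - flux k M \<alpha> v i j))"
    if i: "i \<in> {1..N}" for i
  proof -
    interpret sv_cell k M i using admissible_sv_cell[OF mesh k] i by (simp add: N_def)
    have sub: "{lo..hi} \<subseteq> {0..2 * pi}" using admissible_cell_subset[OF mesh] i by (simp add: N_def)
    have deg: "degree (v i) \<le> k" using v i by (simp add: Vh_def N_def)
    have left: "left_lim M v i = poly (v i) hi" using i by (auto simp: left_lim_def Let_def)
    have right: "right_lim M v (i - 1) = poly (v i) lo" using i by (auto simp: right_lim_def Let_def N_def)
    show ?thesis
      unfolding gl_def gr_def left right
    proof (rule cell_flux_lower_bound[where meth = meth])
      show "point_choice meth \<alpha> M i" using mesh i by (simp add: admissible_mesh_def N_def)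
      show "(hi - lo) * (poly (v i) x)\<^sup>2 \<le> K * n i" if "x \<in> {lo..hi}" for x
        unfolding n_def by (rule inv(1)[OF faces_less deg that])
      show "(hi - lo) ^ 3 * (poly (pderiv (v i)) x)\<^sup>2 \<le> K * n i" if "x \<in> {lo..hi}" for x
        unfolding n_def by (rule inv(2)[OF faces_less deg that])
      show "(hi - lo) * (left_lim M v (i - 1))\<^sup>2 \<le> \<sigma> * K * nl (i - 1)"
        unfolding left_lim_def nl_def Let_def N_def[symmetric] using i N by (intro face_bound) auto
      show "(hi - lo) * (right_lim M v i)\<^sup>2 \<le> \<sigma> * K * nr i"
        unfolding right_lim_def nr_def Let_def N_def[symmetric] using i N by (intro face_bound) auto
      show "continuous_on {lo..hi} \<alpha>'" using \<alpha>(3) sub by (rule continuous_on_subset)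
      show "\<bar>\<alpha> x - \<alpha> y\<bar> \<le> A * \<bar>x - y\<bar>" if "x \<in> {lo..hi}" "y \<in> {lo..hi}" for x y
        using that sub by (intro lip) auto
    qed (use i deg \<alpha>(2) A0 in \<open>auto simp: N_def\<close>)
  qed
  \<comment> \<open>Regrouping the sums from cells to faces uses that both ends of the domain carry the same data.\<close>
  have face_eq: "face M 0 = 0" "face M N = 2 * pi" using mesh by (auto simp: admissible_mesh_def N_def)
  have "\<alpha> (face M 0) = \<alpha> (face M N)"
    using \<alpha>(1) unfolding periodic_def face_eq by (metis add_0)
  moreover have "left_lim M v 0 = left_lim M v N" "right_lim M v 0 = right_lim M v N"
    by (simp_all add: left_lim_def right_lim_def Let_def N_def)
  ultimately have gr_per: "gr 0 = gr N"
    unfolding gr_def upwind_def by (simp only:)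
  have nl_per: "nl 0 = nl N" and nr_per: "nr 0 = nr N" by (simp_all add: nl_def nr_def)
  have "(\<Sum>i=1..N. nl (i - 1)) = (\<Sum>i=1..N. nl i)" by (rule sum_shift_periodic[OF nl_per])
  also have "\<dots> = (\<Sum>i=1..N. n i)" by (intro sum.cong) (auto simp: nl_def)
  finally have nl: "(\<Sum>i=1..N. nl (i - 1)) = (\<Sum>i=1..N. n i)" .
  have "(\<Sum>i=1..N. nr i) = (\<Sum>i=1..N. nr (i - 1))" by (rule sum_shift_periodic[OF nr_per, symmetric])
  also have "\<dots> = (\<Sum>i=1..N. n i)" by (intro sum.cong) (auto simp: nr_def)
  finally have nr: "(\<Sum>i=1..N. nr i) = (\<Sum>i=1..N. n i)" .
  have "0 \<le> (\<Sum>i=1..N. gl i - gr i)"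
    unfolding gl_def gr_def by (intro sum_nonneg upwind_dissipation)
  then have faces: "0 \<le> (\<Sum>i=1..N. gl i) - (\<Sum>i=1..N. gr (i - 1))"
    by (simp only: sum_shift_periodic[OF gr_per] sum_subtractf)
  have "(\<Sum>i=1..N. gl i - gr (i - 1) + integral {face M (i - 1)..face M i} (\<lambda>x. \<alpha>' x * poly (v i) x * poly (v i) x) / 2
      - A * (5 * (K * n i) + (\<sigma> * K * nl (i - 1) + \<sigma> * K * nr i) / 2))
    = (\<Sum>i=1..N. gl i) - (\<Sum>i=1..N. gr (i - 1)) + L2_weighted M \<alpha>' v v / 2
      - A * (5 * (K * (\<Sum>i=1..N. n i)) + (\<sigma> * K * (\<Sum>i=1..N. nl (i - 1)) + \<sigma> * K * (\<Sum>i=1..N. nr i)) / 2)"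
    unfolding L2_weighted_def N_def[symmetric] by (rule cell_bounds_sum)
  also have "\<dots> = (\<Sum>i=1..N. gl i) - (\<Sum>i=1..N. gr (i - 1)) + L2_weighted M \<alpha>' v v / 2
      - A * K * (5 + \<sigma>) * (L2_norm M v)\<^sup>2"
    unfolding nl nr L2_norm_square N_def[symmetric] n_def[symmetric] by (simp add: algebra_simps)
  finally show ?thesis
    using faces sum_mono[OF cell, of "{1..N}" "\<lambda>i. i"] unfolding N_def[symmetric] by simp
qed

section \<open>The time derivative of the energy\<close>

lemma bilinear_sum:
  fixes B :: "real poly \<Rightarrow> real poly \<Rightarrow> real"
  assumes add: "\<And>p q r. B (p + q) r = B p r + B q r" "\<And>p q r. B r (p + q) = B r p + B r q"
    and scale: "\<And>c p q. B (smult c p) q = c * B p q" "\<And>c p q. B p (smult c q) = c * B p q"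
  shows "B (\<Sum>i\<in>I. smult (c i) (f i)) (\<Sum>j\<in>J. smult (d j) (g j)) = (\<Sum>i\<in>I. \<Sum>j\<in>J. c i * d j * B (f i) (g j))"
proof -
  have zero: "B 0 q = 0" "B q 0 = 0" for q
    using scale(1)[of 0 0 q] scale(2)[of q 0 0] by simp_all
  have right: "B p (\<Sum>j\<in>J. smult (d j) (g j)) = (\<Sum>j\<in>J. d j * B p (g j))" for p
    by (induction J rule: infinite_finite_induct) (simp_all add: zero add scale)
  have left: "B (\<Sum>i\<in>I. smult (c i) (f i)) q = (\<Sum>i\<in>I. c i * B (f i) q)" for q
    by (induction I rule: infinite_finite_induct) (simp_all add: zero add scale)
  show ?thesis by (subst left) (simp only: right sum_distrib_left mult.assoc)
qed

text \<open>Differentiability at the points of an interval is enough for the whole polynomial path: Lagrange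
  interpolation at \<open>k + 1\<close> of these points expresses \<open>p s\<close> through finitely many differentiable
  values. The last conclusion is the product rule for bilinear forms on the path.\<close>

lemma polynomial_path_derivative:
  fixes p :: "real \<Rightarrow> real poly"
  assumes ab: "a < b" and deg: "\<And>s. s \<in> S \<Longrightarrow> degree (p s) \<le> k" and t: "t \<in> S"
    and diff: "\<And>x. x \<in> {a..b} \<Longrightarrow> (\<lambda>s. poly (p s) x) differentiable (at t within S)"
  obtains q where "degree q \<le> k"
    and "\<And>x. ((\<lambda>s. poly (p s) x) has_real_derivative poly q x) (at t within S)"
    and "\<And>B. (\<And>p q r. B (p + q) r = B p r + B q r) \<Longrightarrow> (\<And>p q r. B r (p + q) = B r p + B r q) \<Longrightarrow>
           (\<And>c p q. B (smult c p) q = c * B p q) \<Longrightarrow> (\<And>c p q. B p (smult c q) = c * B p q) \<Longrightarrow>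
           ((\<lambda>s. B (p s) (p s)) has_real_derivative B q (p t) + B (p t) q) (at t within S)"
proof -
  have "infinite {a..b}" using ab by (simp add: infinite_Icc)
  \<comment> \<open>The interpolation nodes.\<close>
  then obtain I where I: "finite I" "card I = Suc k" "I \<subseteq> {a..b}"
    using infinite_arbitrarily_large by blast
  let ?l = "lagrange_basis I (\<lambda>x. x)"
  have "\<exists>d. ((\<lambda>s. poly (p s) x) has_real_derivative d) (at t within S)" if "x \<in> I" for x
    using diff[of x] that I by (auto simp: real_differentiable_def)
  then obtain d where d: "\<And>x. x \<in> I \<Longrightarrow> ((\<lambda>s. poly (p s) x) has_real_derivative d x) (at t within S)"
    by metis
  define q where "q = (\<Sum>x\<in>I. smult (d x) (?l x))"
  have p: "p s = (\<Sum>x\<in>I. smult (poly (p s) x) (?l x))" if "s \<in> S" for s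
    using deg[OF that] I by (intro lagrange_interpolation) auto
  have transfer: "(f has_real_derivative D) (at t within S)"
    if "(g has_real_derivative D) (at t within S)" "\<And>s. s \<in> S \<Longrightarrow> f s = g s" for f g D
    using that(2) by (intro has_field_derivative_transform_within[OF that(1) zero_less_one t]) (rule sym)
  show thesis
  proof (rule that[of q])
    show "degree q \<le> k"
      unfolding q_def using I degree_lagrange_basis[of I _ "\<lambda>x. x"]
      by (intro degree_sum_le) (auto intro!: order.trans[OF degree_smult_le])
    show "((\<lambda>s. poly (p s) y) has_real_derivative poly q y) (at t within S)" for y
    proof (rule transfer)
      show "((\<lambda>s. \<Sum>x\<in>I. poly (p s) x * poly (?l x) y) has_real_derivative poly q y) (at t within S)"
        unfolding q_def poly_sum poly_smult by (intro DERIV_sum DERIV_cmult_right d)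
      show "poly (p s) y = (\<Sum>x\<in>I. poly (p s) x * poly (?l x) y)" if "s \<in> S" for s
        by (subst p[OF that]) (simp add: poly_sum)
    qed
    fix B :: "real poly \<Rightarrow> real poly \<Rightarrow> real"
    assume B: "\<And>p q r. B (p + q) r = B p r + B q r" "\<And>p q r. B r (p + q) = B r p + B r q"
      "\<And>c p q. B (smult c p) q = c * B p q" "\<And>c p q. B p (smult c q) = c * B p q"
    note expand = bilinear_sum[of B, OF B]
    show "((\<lambda>s. B (p s) (p s)) has_real_derivative B q (p t) + B (p t) q) (at t within S)"
    proof (rule transfer)
      have "((\<lambda>s. \<Sum>x\<in>I. \<Sum>y\<in>I. poly (p s) x * poly (p s) y * B (?l x) (?l y)) has_real_derivative
          (\<Sum>x\<in>I. \<Sum>y\<in>I. (d x * poly (p t) y + d y * poly (p t) x) * B (?l x) (?l y))) (at t within S)"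
        by (intro DERIV_sum DERIV_cmult_right DERIV_mult d)
      also have "(\<Sum>x\<in>I. \<Sum>y\<in>I. (d x * poly (p t) y + d y * poly (p t) x) * B (?l x) (?l y)) =
          B q (p t) + B (p t) q"
        by (subst (1 2) p[OF t]) (simp add: q_def expand sum.distrib[symmetric] algebra_simps)
      finally show "((\<lambda>s. \<Sum>x\<in>I. \<Sum>y\<in>I. poly (p s) x * poly (p s) y * B (?l x) (?l y)) has_real_derivative
          B q (p t) + B (p t) q) (at t within S)" .
      show "B (p s) (p s) = (\<Sum>x\<in>I. \<Sum>y\<in>I. poly (p s) x * poly (p s) y * B (?l x) (?l y))" if "s \<in> S" for s
        by (subst (1 2) p[OF that]) (simp only: expand)
    qed
  qed
qed

lemma sv_trans_local: "sv_trans k M v i j = sv_trans k M (\<lambda>_. v i) i j"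
  by (induction j) auto

context sv_cell
begin

lemma sv_trans_linear:
  "sv_trans k M (\<lambda>_. p + q) i j = sv_trans k M (\<lambda>_. p) i j + sv_trans k M (\<lambda>_. q) i j"
  "sv_trans k M (\<lambda>_. smult c p) i j = c * sv_trans k M (\<lambda>_. p) i j"
  by (induction j) (simp_all add: pderiv_add pderiv_smult algebra_simps)

lemma cell_pairing_linear:
  "cell_pairing (p + q) r = cell_pairing p r + cell_pairing q r"
  "cell_pairing r (p + q) = cell_pairing r p + cell_pairing r q"
  "cell_pairing (smult c p) q = c * cell_pairing p q"
  "cell_pairing p (smult c q) = c * cell_pairing p q"
  unfolding cell_pairing_def sv_trans_linear integral_poly_add integral_poly_smult
  by (simp_all only: sum.distrib[symmetric] sum_distrib_left) (simp_all add: algebra_simps)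

text \<open>In the form \<open>a\<^sub>h(u, T u)\<close> the pointwise time derivative is again a polynomial on the cell, so the
  time term is a cell pairing.\<close>

lemma a_cell_eq:
  assumes T: "T > 0" "t \<in> {0..T}"
    and q: "\<And>x. ((\<lambda>s. poly (u s i) x) has_real_derivative poly q x) (at t within {0..T})"
  shows "a_cell T k M \<alpha> u t (sv_trans k M (u t)) i = cell_pairing q (u t i) +
    (\<Sum>j=0..k. sv_trans k M (u t) i j * (flux k M \<alpha> (u t) i (j + 1) - flux k M \<alpha> (u t) i j))"
proof -
  have "time_deriv T u t i = poly q"
  proof
    fix x
    show "time_deriv T u t i x = poly q x"
      unfolding time_deriv_def using T q
      by (intro vector_derivative_within_closed_interval)
         (simp_all flip: has_real_derivative_iff_has_vector_derivative)
  qed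
  moreover have "sv_trans k M (\<lambda>_. u t i) i j = sv_trans k M (u t) i j" for j
    by (rule sv_trans_local[symmetric])
  ultimately show ?thesis by (simp only: a_cell_def cell_pairing_def)
qed

end

text \<open>One formula for both methods: for LSV it holds by definition, for RSV because the pairing at Radau
  points is the \<open>L\<^sup>2\<close> inner product.\<close>

lemma energy_norm_eq:
  assumes mesh: "admissible_mesh meth k \<sigma> \<alpha> M" and k: "k \<ge> 1" and v: "v \<in> Vh k M"
  shows "energy_norm meth k M v = sqrt (\<Sum>i=1..cells M. sv_cell.cell_pairing k M i (v i) (v i))"
proof -
  have cell: "sv_cell k M i" if "i \<in> {1..cells M}" for i using admissible_sv_cell[OF mesh k that] .
  have deg: "degree (v i) \<le> k" if "i \<in> {1..cells M}" for i using v that by (simp add: Vh_def)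
  show ?thesis
  proof (cases meth)
    case LSV
    have "cv_inner k M (\<lambda>i. poly (v i)) (sv_trans k M v) =
        (\<Sum>i=1..cells M. sv_cell.cell_pairing k M i (v i) (v i))"
      unfolding cv_inner_def
    proof (intro sum.cong refl)
      fix i assume i: "i \<in> {1..cells M}"
      have "sv_trans k M (\<lambda>_. v i) i j = sv_trans k M v i j" for j by (rule sv_trans_local[symmetric])
      then show "(\<Sum>j=0..k. sv_trans k M v i j * integral {pt M i j..pt M i (j + 1)} (poly (v i))) =
          sv_cell.cell_pairing k M i (v i) (v i)"
        by (simp only: sv_cell.cell_pairing_def[OF cell[OF i]])
    qed
    then show ?thesis using LSV by (simp add: triple_norm_def)
  next
    case RSV
    have "sv_cell.cell_pairing k M i (v i) (v i) = integral {face M (i - 1)..face M i} (poly (v i * v i))"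
      if i: "i \<in> {1..cells M}" for i
    proof (rule sv_cell.cell_pairing_Radau[OF cell[OF i] deg[OF i]])
      have "point_choice RSV \<alpha> M i" using mesh i RSV by (simp add: admissible_mesh_def)
      then show "kind M i \<noteq> Gauss" by auto
    qed
    then have "(\<Sum>i=1..cells M. sv_cell.cell_pairing k M i (v i) (v i)) = (L2_norm M v)\<^sup>2"
      unfolding L2_norm_square by (rule sum.cong[OF refl])
    then show ?thesis using RSV L2_norm_nonneg[of M v] by simp
  qed
qed

lemma
  assumes mesh: "admissible_mesh meth k \<sigma> \<alpha> M" and k: "k \<ge> 1" and v: "v \<in> Vh k M"
  shows energy_norm_square: "(energy_norm meth k M v)\<^sup>2 = (\<Sum>i=1..cells M. sv_cell.cell_pairing k M i (v i) (v i))"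
    and L2_norm_le_energy_norm: "(L2_norm M v)\<^sup>2 \<le> (energy_norm meth k M v)\<^sup>2"
    and energy_norm_nonneg: "0 \<le> energy_norm meth k M v"
proof -
  let ?S = "\<Sum>i=1..cells M. sv_cell.cell_pairing k M i (v i) (v i)"
  have "(L2_norm M v)\<^sup>2 \<le> ?S"
    unfolding L2_norm_square using v
    by (intro sum_mono sv_cell.cell_pairing_ge admissible_sv_cell[OF mesh k]) (auto simp: Vh_def)
  moreover from this have "0 \<le> ?S" by (rule order.trans[OF zero_le_power2])
  ultimately show "(energy_norm meth k M v)\<^sup>2 = ?S" "(L2_norm M v)\<^sup>2 \<le> (energy_norm meth k M v)\<^sup>2"
    "0 \<le> energy_norm meth k M v"
    by (simp_all add: energy_norm_eq[OF mesh k v])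
qed

text \<open>The derivative of the energy is \<open>(u\<^sub>t, T u) + (u, T u\<^sub>t) = 2 (u\<^sub>t, T u)\<close> by symmetry of the
  pairing, and \<open>(u\<^sub>t, T u)\<close> is what remains of \<open>a\<^sub>h(u, T u)\<close> without the flux term.\<close>

lemma energy_derivative:
  assumes mesh: "admissible_mesh meth k \<sigma> \<alpha> M" and k: "k \<ge> 1" and T: "T > 0" "t \<in> {0..T}"
    and u: "\<And>s. s \<in> {0..T} \<Longrightarrow> u s \<in> Vh k M" "time_differentiable T M u"
  shows "((\<lambda>s. (energy_norm meth k M (u s))\<^sup>2) has_real_derivative
    2 * (a_form T k M \<alpha> u t (sv_trans k M (u t)) - (\<Sum>i=1..cells M. \<Sum>j=0..k.
      sv_trans k M (u t) i j * (flux k M \<alpha> (u t) i (j + 1) - flux k M \<alpha> (u t) i j)))) (at t within {0..T})"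
proof -
  let ?F = "\<lambda>i. \<Sum>j=0..k. sv_trans k M (u t) i j * (flux k M \<alpha> (u t) i (j + 1) - flux k M \<alpha> (u t) i j)"
  have cell: "((\<lambda>s. sv_cell.cell_pairing k M i (u s i) (u s i)) has_real_derivative
      2 * (a_cell T k M \<alpha> u t (sv_trans k M (u t)) i - ?F i)) (at t within {0..T})"
    if i: "i \<in> {1..cells M}" for i
  proof -
    interpret sv_cell k M i using admissible_sv_cell[OF mesh k i] .
    have deg: "degree (u s i) \<le> k" if "s \<in> {0..T}" for s using u(1)[OF that] i by (simp add: Vh_def)
    have diff: "(\<lambda>s. poly (u s i) x) differentiable (at t within {0..T})" if "x \<in> {lo..hi}" for x
      using u(2) T i that unfolding time_differentiable_def by blast
    obtain q where q: "degree q \<le> k"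
      "\<And>x. ((\<lambda>s. poly (u s i) x) has_real_derivative poly q x) (at t within {0..T})"
      "\<And>B. (\<And>p q r. B (p + q) r = B p r + B q r) \<Longrightarrow> (\<And>p q r. B r (p + q) = B r p + B r q) \<Longrightarrow>
           (\<And>c p q. B (smult c p) q = c * B p q) \<Longrightarrow> (\<And>c p q. B p (smult c q) = c * B p q) \<Longrightarrow>
           ((\<lambda>s. B (u s i) (u s i)) has_real_derivative B q (u t i) + B (u t i) q) (at t within {0..T})"
      using polynomial_path_derivative[of lo hi "{0..T}" "\<lambda>s. u s i" k t, OF faces_less deg T(2) diff] by blast
    have "cell_pairing q (u t i) = a_cell T k M \<alpha> u t (sv_trans k M (u t)) i - ?F i"
      using a_cell_eq[OF T, of u q \<alpha>] q(2) by simp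
    moreover have "cell_pairing (u t i) q = cell_pairing q (u t i)"
      by (rule cell_pairing_commute[OF deg[OF T(2)] q(1)])
    ultimately show ?thesis
      using q(3)[of cell_pairing, OF cell_pairing_linear] by simp
  qed
  have "((\<lambda>s. \<Sum>i=1..cells M. sv_cell.cell_pairing k M i (u s i) (u s i)) has_real_derivative
      (\<Sum>i=1..cells M. 2 * (a_cell T k M \<alpha> u t (sv_trans k M (u t)) i - ?F i))) (at t within {0..T})"
    by (intro DERIV_sum cell)
  then have "((\<lambda>s. (energy_norm meth k M (u s))\<^sup>2) has_real_derivative
      (\<Sum>i=1..cells M. 2 * (a_cell T k M \<alpha> u t (sv_trans k M (u t)) i - ?F i))) (at t within {0..T})"
    by (rule has_field_derivative_transform_within[OF _ zero_less_one T(2)])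
       (rule energy_norm_square[OF mesh k u(1), symmetric])
  then show ?thesis
    by (simp only: a_form_def sum_distrib_left[symmetric] sum_subtractf)
qed

section \<open>Stability\<close>

lemma gronwall_differential:
  fixes f :: "real \<Rightarrow> real"
  assumes deriv: "\<And>s. s \<in> {0..T} \<Longrightarrow> (f has_real_derivative f' s) (at s within {0..T})"
    and bound: "\<And>s. s \<in> {0..T} \<Longrightarrow> f' s \<le> c * f s"
    and t: "t \<in> {0..T}"
  shows "f t \<le> exp (c * t) * f 0"
proof -
  let ?g = "\<lambda>s. exp (- c * s) * f s"
  have g: "(?g has_real_derivative exp (- c * s) * (f' s - c * f s)) (at s within {0..T})" if "s \<in> {0..T}" for s
    by (auto intro!: derivative_eq_intros deriv[OF that] simp: algebra_simps)
  have "?g t \<le> ?g 0"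
  proof (rule DERIV_nonpos_imp_decreasing_open[of 0 t])
    show "0 \<le> t" using t by simp
    show "continuous_on {0..t} ?g"
      using g t
      by (intro continuous_on_subset[of "{0..T}" _ "{0..t}"] DERIV_continuous_on) auto
    fix x assume x: "0 < x" "x < t"
    then have "at x within {0..T} = at x" using t by (intro at_within_interior) (auto simp: interior_atLeastAtMost_real)
    then have "(?g has_real_derivative exp (- c * x) * (f' x - c * f x)) (at x)" using g[of x] x t by auto
    moreover have "exp (- c * x) * (f' x - c * f x) \<le> 0"
      using bound[of x] x t by (intro mult_nonneg_nonpos) auto
    ultimately show "\<exists>y. (?g has_real_derivative y) (at x) \<and> y \<le> 0" by blast
  qed
  then have "exp (c * t) * ?g t \<le> exp (c * t) * f 0" by (intro mult_left_mono) auto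
  then show ?thesis by (simp add: mult.assoc[symmetric] flip: exp_add)
qed

lemma L2_weighted_bound:
  assumes mesh: "admissible_mesh meth k \<sigma> \<alpha> M"
    and b: "continuous_on {0..2 * pi} b" "\<And>x. x \<in> {0..2 * pi} \<Longrightarrow> \<bar>b x\<bar> \<le> A"
  shows "- L2_weighted M b v v \<le> A * (L2_norm M v)\<^sup>2"
  unfolding L2_weighted_def L2_norm_square sum_distrib_left sum_negf[symmetric]
proof (rule sum_mono)
  fix i assume i: "i \<in> {1..cells M}"
  let ?I = "{face M (i - 1)..face M i}"
  have sub: "?I \<subseteq> {0..2 * pi}" by (rule admissible_cell_subset[OF mesh i])
  then have cont: "continuous_on ?I b" using b(1) continuous_on_subset by blast
  have "- integral ?I (\<lambda>x. b x * poly (v i) x * poly (v i) x) =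
      integral ?I (\<lambda>x. - (b x * poly (v i) x * poly (v i) x))" by simp
  also have "\<dots> \<le> integral ?I (poly (smult A (v i * v i)))"
  proof (rule integral_le)
    show "(\<lambda>x. - (b x * poly (v i) x * poly (v i) x)) integrable_on ?I"
      by (intro integrable_continuous_interval continuous_intros cont)
    fix x assume "x \<in> ?I"
    then have "- b x \<le> A" using b(2)[of x] sub by fastforce
    then have "- b x * (poly (v i) x * poly (v i) x) \<le> A * (poly (v i) x * poly (v i) x)"
      by (rule mult_right_mono) simp
    then show "- (b x * poly (v i) x * poly (v i) x) \<le> poly (smult A (v i * v i)) x" by simp
  qed simp
  finally show "- integral ?I (\<lambda>x. b x * poly (v i) x * poly (v i) x) \<le> A * integral ?I (poly (v i * v i))"
    by (simp only: integral_poly_smult)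
qed

lemma smooth_velocity:
  assumes "smooth \<alpha>"
  shows "(\<alpha> has_real_derivative deriv \<alpha> x) (at x)" and "continuous_on S (deriv \<alpha>)"
proof -
  have "(deriv ^^ 0) \<alpha> field_differentiable at x" "(deriv ^^ 1) \<alpha> field_differentiable at y" for x y
    using assms unfolding smooth_def by blast+
  then have diff: "\<alpha> field_differentiable at x" "deriv \<alpha> field_differentiable at y" for x y by simp_all
  show "(\<alpha> has_real_derivative deriv \<alpha> x) (at x)"
    using diff(1) by (simp add: DERIV_deriv_iff_field_differentiable)
  show "continuous_on S (deriv \<alpha>)"
    using diff(2) by (intro continuous_at_imp_continuous_on ballI field_differentiable_imp_continuous_at)
qed

theorem theorem3p2:
  fixes k :: nat and T \<sigma> :: real
    and \<alpha> :: "real \<Rightarrow> real" and g :: "real \<Rightarrow> real \<Rightarrow> real"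
    and meth :: sv_method
  assumes "k \<ge> 1" and "T > 0"
    and "smooth \<alpha>" and "periodic \<alpha>" and "finite (turning_points \<alpha>)"
    and "smooth_strip T g" and "\<forall>t\<in>{0..T}. periodic (\<lambda>x. g x t)"
  shows
    "(\<exists>C>0. \<forall>M u.
        admissible_mesh meth k \<sigma> \<alpha> M \<and> sv_solution T k M \<alpha> g u \<longrightarrow>
        (\<forall>t\<in>{0..T}. \<exists>D.
           ((\<lambda>s. (energy_norm meth k M (u s))\<^sup>2) has_real_derivative D) (at t within {0..T}) \<and>
           1 / 2 * D \<le> - (1 / 2) * L2_weighted M (deriv \<alpha>) (u t) (u t)
                        + a_form T k M \<alpha> u t (sv_trans k M (u t))
                        + C * (L2_norm M (u t))\<^sup>2)) \<and>
     ((\<forall>x. \<forall>t\<in>{0..T}. g x t = 0) \<longrightarrow>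
      (\<exists>C>0. \<forall>M u.
        admissible_mesh meth k \<sigma> \<alpha> M \<and> sv_solution T k M \<alpha> g u \<longrightarrow>
        (\<forall>t\<in>{0<..T}. energy_norm meth k M (u t) \<le> C * energy_norm meth k M (u 0))))"
proof -
  note k = assms(1) and T = assms(2)
  have \<alpha>: "(\<alpha> has_real_derivative deriv \<alpha> x) (at x)" "continuous_on S (deriv \<alpha>)" for x S
    using smooth_velocity[OF assms(3)] by auto
  have "bounded (deriv \<alpha> ` {0..2 * pi})"
    by (intro compact_imp_bounded compact_continuous_image \<alpha>) simp
  then obtain A where "\<forall>y\<in>deriv \<alpha> ` {0..2 * pi}. norm y \<le> A"
    by (auto simp: bounded_iff)
  then have A: "\<bar>deriv \<alpha> x\<bar> \<le> A" if "x \<in> {0..2 * pi}" for x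
    using that by simp
  have A0: "A \<ge> 0" using A[of 0] by (auto intro: order.trans[OF abs_ge_zero])
  obtain K :: real where K: "K > 0"
    and inv: "\<And>a b (p :: real poly) x. a < b \<Longrightarrow> degree p \<le> k \<Longrightarrow> x \<in> {a..b} \<Longrightarrow>
           (b - a) * (poly p x)\<^sup>2 \<le> K * integral {a..b} (poly (p * p))"
      "\<And>a b (p :: real poly) x. a < b \<Longrightarrow> degree p \<le> k \<Longrightarrow> x \<in> {a..b} \<Longrightarrow>
           (b - a) ^ 3 * (poly (pderiv p) x)\<^sup>2 \<le> K * integral {a..b} (poly (p * p))"
    using inverse_estimate[of k] by blast
  \<comment> \<open>The modulus keeps \<open>C\<close> positive for every \<open>\<sigma>\<close>; an admissible mesh forces \<open>\<sigma> > 0\<close>.\<close>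
  define C where "C = A * K * (5 + \<bar>\<sigma>\<bar>) + 1"
  \<comment> \<open>The Gronwall constant for the squared norm; \<open>- (\<alpha>' u, u)\<close> is at most \<open>A (u, u)\<close>.\<close>
  define c where "c = A + 2 * C"
  have C: "C > 0" using A0 K by (simp add: C_def add_nonneg_pos)
  define D where "D M u t = 2 * (a_form T k M \<alpha> u t (sv_trans k M (u t)) - (\<Sum>i=1..cells M. \<Sum>j=0..k.
      sv_trans k M (u t) i j * (flux k M \<alpha> (u t) i (j + 1) - flux k M \<alpha> (u t) i j)))" for M u t
  have derivative: "((\<lambda>s. (energy_norm meth k M (u s))\<^sup>2) has_real_derivative D M u t) (at t within {0..T})"
    if "admissible_mesh meth k \<sigma> \<alpha> M" "sv_solution T k M \<alpha> g u" "t \<in> {0..T}" for M u t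
    unfolding D_def using that(2) by (intro energy_derivative[OF that(1) k T that(3)]) (auto simp: sv_solution_def)
  have estimate: "1 / 2 * D M u t \<le> - (1 / 2) * L2_weighted M (deriv \<alpha>) (u t) (u t)
      + a_form T k M \<alpha> u t (sv_trans k M (u t)) + C * (L2_norm M (u t))\<^sup>2"
    if mesh: "admissible_mesh meth k \<sigma> \<alpha> M" and "sv_solution T k M \<alpha> g u" "t \<in> {0..T}" for M u t
  proof -
    have "u t \<in> Vh k M" using that by (auto simp: sv_solution_def)
    note flux = flux_form_lower_bound[OF mesh k this assms(4) \<alpha> A inv]
    have "A * K * (5 + \<sigma>) * (L2_norm M (u t))\<^sup>2 \<le> C * (L2_norm M (u t))\<^sup>2"
    proof (rule mult_right_mono)
      have "A * K * (5 + \<sigma>) \<le> A * K * (5 + \<bar>\<sigma>\<bar>)" using A0 K by (intro mult_left_mono) auto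
      then show "A * K * (5 + \<sigma>) \<le> C" by (simp add: C_def)
    qed simp
    with flux show ?thesis by (simp add: D_def)
  qed
  have stable: "energy_norm meth k M (u t) \<le> exp (c * T / 2) * energy_norm meth k M (u 0)"
    if g: "\<forall>x. \<forall>t\<in>{0..T}. g x t = 0"
      and mesh: "admissible_mesh meth k \<sigma> \<alpha> M" and u: "sv_solution T k M \<alpha> g u" and t: "t \<in> {0<..T}" for M u t
  proof -
    have V: "u s \<in> Vh k M" if "s \<in> {0..T}" for s using u that by (auto simp: sv_solution_def)
    have c: "c \<ge> 0" using A0 C by (simp add: c_def)
    have "D M u s \<le> c * (energy_norm meth k M (u s))\<^sup>2" if s: "s \<in> {0..T}" for s
    proof -
      have "a_form T k M \<alpha> u s w = cv_inner k M (\<lambda>i x. g x s) w" for w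
        using u s by (simp add: sv_solution_def)
      moreover have "cv_inner k M (\<lambda>i x. g x s) w = 0" for w
        using g s by (simp add: cv_inner_def)
      ultimately have "D M u s \<le> - L2_weighted M (deriv \<alpha>) (u s) (u s) + 2 * (C * (L2_norm M (u s))\<^sup>2)"
        using estimate[OF mesh u s] by simp
      also have "\<dots> \<le> A * (L2_norm M (u s))\<^sup>2 + 2 * (C * (L2_norm M (u s))\<^sup>2)"
        by (intro add_right_mono L2_weighted_bound[OF mesh \<alpha>(2) A])
      also have "\<dots> = c * (L2_norm M (u s))\<^sup>2" by (simp add: c_def algebra_simps)
      also have "\<dots> \<le> c * (energy_norm meth k M (u s))\<^sup>2"
        using L2_norm_le_energy_norm[OF mesh k V[OF s]] c by (rule mult_left_mono)
      finally show ?thesis .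
    qed
    then have "(energy_norm meth k M (u t))\<^sup>2 \<le> exp (c * t) * (energy_norm meth k M (u 0))\<^sup>2"
      using t by (intro gronwall_differential[where T = T and f' = "D M u"] derivative[OF mesh u]) auto
    also have "\<dots> \<le> exp (c * T) * (energy_norm meth k M (u 0))\<^sup>2"
      using t c by (intro mult_right_mono) (auto intro!: mult_left_mono)
    also have "\<dots> = (exp (c * T / 2) * energy_norm meth k M (u 0))\<^sup>2"
      by (simp add: power_mult_distrib flip: exp_double)
    finally have squares: "(energy_norm meth k M (u t))\<^sup>2 \<le> (exp (c * T / 2) * energy_norm meth k M (u 0))\<^sup>2" .
    have "u 0 \<in> Vh k M" using T by (intro V) simp
    then have "0 \<le> exp (c * T / 2) * energy_norm meth k M (u 0)"
      by (intro mult_nonneg_nonneg exp_ge_zero energy_norm_nonneg[OF mesh k])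
    with squares show ?thesis by (rule power2_le_imp_le)
  qed
  show ?thesis
  proof (rule conjI)
    show "\<exists>C>0. \<forall>M u. admissible_mesh meth k \<sigma> \<alpha> M \<and> sv_solution T k M \<alpha> g u \<longrightarrow>
        (\<forall>t\<in>{0..T}. \<exists>D.
           ((\<lambda>s. (energy_norm meth k M (u s))\<^sup>2) has_real_derivative D) (at t within {0..T}) \<and>
           1 / 2 * D \<le> - (1 / 2) * L2_weighted M (deriv \<alpha>) (u t) (u t)
                        + a_form T k M \<alpha> u t (sv_trans k M (u t)) + C * (L2_norm M (u t))\<^sup>2)"
    proof (rule exI[of _ C], intro conjI C allI impI ballI, elim conjE)
      fix M u t assume "t \<in> {0..T}" "admissible_mesh meth k \<sigma> \<alpha> M" "sv_solution T k M \<alpha> g u"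
      then show "\<exists>D. ((\<lambda>s. (energy_norm meth k M (u s))\<^sup>2) has_real_derivative D) (at t within {0..T}) \<and>
          1 / 2 * D \<le> - (1 / 2) * L2_weighted M (deriv \<alpha>) (u t) (u t)
                       + a_form T k M \<alpha> u t (sv_trans k M (u t)) + C * (L2_norm M (u t))\<^sup>2"
        by (intro exI[of _ "D M u t"] conjI derivative estimate)
    qed
    show "(\<forall>x. \<forall>t\<in>{0..T}. g x t = 0) \<longrightarrow> (\<exists>C>0. \<forall>M u.
        admissible_mesh meth k \<sigma> \<alpha> M \<and> sv_solution T k M \<alpha> g u \<longrightarrow>
        (\<forall>t\<in>{0<..T}. energy_norm meth k M (u t) \<le> C * energy_norm meth k M (u 0)))"
    proof (intro impI exI[of _ "exp (c * T / 2)"] conjI exp_gt_zero allI ballI, elim conjE)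
      fix M u t
      assume "\<forall>x. \<forall>t\<in>{0..T}. g x t = 0" "t \<in> {0<..T}"
        "admissible_mesh meth k \<sigma> \<alpha> M" "sv_solution T k M \<alpha> g u"
      then show "energy_norm meth k M (u t) \<le> exp (c * T / 2) * energy_norm meth k M (u 0)"
        by (intro stable)
    qed
  qed
qed

end
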